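(* Let $q\geq 1$ and let $f$ be a function with a logarithmic tract $D$. Suppose that, for each $\varepsilon>0$, there exists $r_\varepsilon>0$ such that $$|f(z)|\leq \exp\left( \exp\left(\left(\log|z|\right)^{q+\varepsilon}\right)\right)\quad \text{for all } z\in D \text{ with } |z|\geq r_\varepsilon .$$ Then $\dim I(f,D)\geq 1+\dfrac1q$.
   Context: For $R>0$ put $\Delta_R=\{z\in\mathbb{C}:|z|>R\}$. Let $D\subset\mathbb{C}$ be an unbounded domain whose boundary consists of piecewise smooth curves, and suppose that the complement of $D$ is unbounded. Let $f$ be a complex-valued function whose domain of definition contains the closure $\overline{D}$ of $D$. Then $D$ is called a logarithmic tract of $f$ if $f$ is holomorphic in $D$ and continuous in $\overline{D}$ and if there exists $R>0$ such that $f:D\to\Delta_R$ is a universal covering. For a logarithmic tract $D$ of $f$, $$I(f,D)=\{z\in D: f^n(z)\in D \text{ for all } n\in\mathbb{N} \text{ and } f^n(z)\to\infty \text{ as } n\to\infty\},$$ where $f^n$ denotes the $n$th iterate of $f$. $\dim$ denotes Hausdorff dimension. *)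

theory Defs
  imports "HOL-Analysis.Analysis"
begin

section \<open>Hausdorff dimension\<close>

text \<open>The convention that a nonempty set has diameter to the power 0 equal to 1
  (whereas \<^term>\<open>0 powr 0 = (0::real)\<close>) makes the 0-dimensional measure the counting measure.\<close>

definition diam_pow :: "real \<Rightarrow> 'a::metric_space set \<Rightarrow> ennreal" where
  "diam_pow s U = (if U = {} then 0 else if s = 0 then 1 else ennreal (diameter U powr s))"

text \<open>Boundedness is required because \<^const>\<open>diameter\<close> is unspecified on unbounded sets.\<close>

definition hausdorff_premeasure :: "real \<Rightarrow> real \<Rightarrow> 'a::metric_space set \<Rightarrow> ennreal" where
  "hausdorff_premeasure s \<delta> A =
     (INF U \<in> {U :: nat \<Rightarrow> 'a set. A \<subseteq> (\<Union>i. U i) \<and> (\<forall>i. bounded (U i) \<and> diameter (U i) \<le> \<delta>)}.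
        \<Sum>i. diam_pow s (U i))"

definition hausdorff_measure :: "real \<Rightarrow> 'a::metric_space set \<Rightarrow> ennreal" where
  "hausdorff_measure s A = (SUP \<delta> \<in> {0<..}. hausdorff_premeasure s \<delta> A)"

definition hausdorff_dim :: "'a::metric_space set \<Rightarrow> ennreal" where
  "hausdorff_dim A = (INF s \<in> {s. 0 \<le> s \<and> hausdorff_measure s A = 0}. ennreal s)"


section \<open>Piecewise smooth curves\<close>

text \<open>Smooth means continuously differentiable with nonvanishing derivative, one-sided at the
  endpoints. Without the latter condition constant curves would be smooth, and every set would be
  a union of traces of smooth curves.\<close>

definition smooth_on_segment :: "real \<Rightarrow> real \<Rightarrow> (real \<Rightarrow> complex) \<Rightarrow> bool" where
  "smooth_on_segment a b \<gamma> \<longleftrightarrow>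
     (\<exists>\<gamma>'. continuous_on {a..b} \<gamma>' \<and>
        (\<forall>t\<in>{a..b}. (\<gamma> has_vector_derivative \<gamma>' t) (at t within {a..b}) \<and> \<gamma>' t \<noteq> 0))"

definition piecewise_smooth_on_segment :: "real \<Rightarrow> real \<Rightarrow> (real \<Rightarrow> complex) \<Rightarrow> bool" where
  "piecewise_smooth_on_segment a b \<gamma> \<longleftrightarrow>
     continuous_on {a..b} \<gamma> \<and>
     (\<exists>S. finite S \<and> {a, b} \<subseteq> S \<and> S \<subseteq> {a..b} \<and>
        (\<forall>u\<in>S. \<forall>v\<in>S. u < v \<and> {u<..<v} \<inter> S = {} \<longrightarrow> smooth_on_segment u v \<gamma>))"

text \<open>The parameter interval need be neither compact nor bounded, since boundary curves of
  unbounded domains may tend to infinity.\<close>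

definition piecewise_smooth_curve :: "real set \<Rightarrow> (real \<Rightarrow> complex) \<Rightarrow> bool" where
  "piecewise_smooth_curve T \<gamma> \<longleftrightarrow>
     is_interval T \<and> interior T \<noteq> {} \<and>
     (\<forall>a\<in>T. \<forall>b\<in>T. a < b \<longrightarrow> piecewise_smooth_on_segment a b \<gamma>)"

definition consists_of_piecewise_smooth_curves :: "complex set \<Rightarrow> bool" where
  "consists_of_piecewise_smooth_curves B \<longleftrightarrow>
     (\<exists>\<Gamma>. (\<forall>(T, \<gamma>)\<in>\<Gamma>. piecewise_smooth_curve T \<gamma>) \<and> B = (\<Union>(T, \<gamma>)\<in>\<Gamma>. \<gamma> ` T))"


section \<open>Logarithmic tracts\<close>

definition universal_covering ::
    "'a::real_normed_vector set \<Rightarrow> ('a \<Rightarrow> 'b::topological_space) \<Rightarrow> 'b set \<Rightarrow> bool" where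
  "universal_covering C p S \<longleftrightarrow> covering_space C p S \<and> simply_connected C"

definition Delta :: "real \<Rightarrow> complex set" where
  "Delta R = {z. cmod z > R}"

text \<open>The function is only defined on some superset of \<^term>\<open>closure D\<close>; it is represented by a
  total function whose values outside \<^term>\<open>closure D\<close> are unconstrained.\<close>

definition logarithmic_tract :: "(complex \<Rightarrow> complex) \<Rightarrow> complex set \<Rightarrow> bool" where
  "logarithmic_tract f D \<longleftrightarrow>
     open D \<and> connected D \<and> \<not> bounded D \<and>
     consists_of_piecewise_smooth_curves (frontier D) \<and>
     \<not> bounded (- D) \<and>
     f holomorphic_on D \<and> continuous_on (closure D) f \<and>
     (\<exists>R>0. universal_covering D f (Delta R))"

text \<open>Requiring every iterate to lie in \<^term>\<open>D\<close> ensures that the iterates involve only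
  values of \<^term>\<open>f\<close> on \<^term>\<open>D\<close>.\<close>

definition escaping_set :: "(complex \<Rightarrow> complex) \<Rightarrow> complex set \<Rightarrow> complex set" where
  "escaping_set f D =
     {z\<in>D. (\<forall>n. (f ^^ n) z \<in> D) \<and> filterlim (\<lambda>n. (f ^^ n) z) at_infinity sequentially}"

end

theory Submission
  imports Defs "HOL-Complex_Analysis.Complex_Analysis" "HOL-Real_Asymp.Real_Asymp"
begin

text \<open>Write \<^term>\<open>f\<close> in logarithmic coordinates. Since \<^term>\<open>D\<close> is simply connected and
  \<^term>\<open>f\<close> covers the exterior of a disc, just as \<open>exp\<close> covers it from a right half-plane, there
  is a univalent function \<open>exp \<circ> G\<close> from a half-plane \<open>{Re z > \<rho>}\<close> into \<^term>\<open>D\<close> with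
  \<open>f (exp (G z)) = exp z\<close> (\<open>tract_log_coordinate\<close>). A sequence of points with
  \<open>z\<^sub>n = G z\<^sub>n\<^sub>+\<^sub>1 + 2 \<pi> i k\<^sub>n\<close> and \<open>Re z\<^sub>n \<rightarrow> \<infinity>\<close> therefore gives a point \<open>exp (G z\<^sub>0)\<close> of the escaping
  set, and it suffices to produce many such sequences.

  Consider a disc of radius \<open>r\<close> about a large real number \<open>t\<close>, with \<open>r\<close> almost as large as \<open>t\<close>. As
  \<open>x\<close> runs through the reals, \<open>Re G(x)\<close> crosses the interval from \<open>t\<close> to \<open>t + r/4\<close>. The growth
  condition says \<open>ln x \<le> (Re G(x))\<^bsup>q+\<epsilon>\<^esup>\<close>, so the whole crossing takes place while \<open>ln x\<close> increases by at
  most about \<open>t\<^bsup>q+\<epsilon>\<^esup>\<close>. Hence, if the interval is divided into cells of length slightly below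
  \<open>t\<^bsup>1-q\<^esup>\<close>, at least half of the cells contain a value \<open>Re G(x)\<close> at which
  \<open>x \<bar>G'(x)\<bar>\<close> is no smaller than the cell (\<open>many_slow_crossings\<close>, \<open>good_positions\<close>). By distortion,
  \<open>G\<close> maps a disc about such an \<open>x\<close>, again of radius almost comparable with \<open>x\<close>, onto a nearly round
  set of the size \<open>t\<^bsup>1-q\<^esup>\<close> of the cell. Translates by multiples of \<open>2 \<pi> i\<close> multiply these sets, so the
  disc contains about \<open>t \<cdot> t / t\<^bsup>1-q\<^esup> = t\<^bsup>1+q\<^esup>\<close> copies of discs of the next generation, each scaled by
  about \<open>t\<^bsup>-q\<^esup>\<close>. The similarity dimension of this pattern is \<open>(1 + q) / q = 1 + 1 / q\<close>.

  To turn the count into a bound for Hausdorff dimension one needs two further properties. All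
  finite compositions of the maps \<open>G + 2 \<pi> i k\<close> are univalent, so one distortion constant serves
  for every generation, and it is absorbed by starting with \<open>t\<close> large. The copies lie in a
  lattice with horizontal spacing \<open>t\<^bsup>1-q\<^esup>\<close> and vertical spacing \<open>2 \<pi>\<close>, so that no set of intermediate diameter meets
  too many of them (\<open>branching\<close>). With these, a covering argument on trees
  (\<open>hausdorff_measure_pos_of_tree\<close>) shows that the \<open>s\<close>-dimensional measure is positive
  for every \<open>s\<close> between \<open>1\<close> and \<open>1 + 1 / q\<close>.\<close>

section \<open>A lower bound for the Hausdorff measure of tree-like sets\<close>

text \<open>A tree has nodes \<open>u\<close> with child sets \<open>ch u\<close> and pieces \<open>P u\<close>. A node is captured by a
  cover if every branch below it arrives, after finitely many steps, at a piece that lies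
  in a single member of the cover. Rule induction on this predicate replaces the choice of a common
  depth for all branches.\<close>

inductive captured :: "('n \<Rightarrow> 'n set) \<Rightarrow> ('n \<Rightarrow> 'a set) \<Rightarrow> (nat \<Rightarrow> 'a set) \<Rightarrow> 'n \<Rightarrow> bool"
  for ch P V where
  contained: "P u \<subseteq> V i \<Longrightarrow> captured ch P V u"
| children: "(\<And>v. v \<in> ch u \<Longrightarrow> captured ch P V v) \<Longrightarrow> captured ch P V u"

text \<open>Koenig's lemma in contrapositive form: a node that is not captured has a child that is not
  captured, and so starts an infinite branch along which no piece lies in a member of the cover.\<close>

lemma captured_if_limits_covered:
  assumes "\<And>\<sigma>. \<sigma> 0 = u \<Longrightarrow> (\<And>n. \<sigma> (Suc n) \<in> ch (\<sigma> n)) \<Longrightarrow> \<exists>n i. P (\<sigma> n) \<subseteq> V i"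
  shows "captured ch P V u"
proof (rule ccontr)
  assume not: "\<not> captured ch P V u"
  have "\<exists>v. v \<in> ch w \<and> \<not> captured ch P V v" if "\<not> captured ch P V w" for w
    using that captured.children by metis
  then obtain nxt where nxt: "\<And>w. \<not> captured ch P V w \<Longrightarrow> nxt w \<in> ch w \<and> \<not> captured ch P V (nxt w)"
    by metis
  define \<sigma> where "\<sigma> n = (nxt ^^ n) u" for n
  have bad: "\<not> captured ch P V (\<sigma> n)" for n
    by (induction n) (auto simp: \<sigma>_def not nxt)
  have "\<exists>n i. P (\<sigma> n) \<subseteq> V i"
    by (rule assms) (use bad nxt in \<open>auto simp: \<sigma>_def\<close>)
  then show False
    using bad captured.contained by metis
qed

text \<open>The three quantitative conditions under which the children of a node carry the \<open>s\<close>-dimensional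
  mass of their parent: they are nested in it, they are numerous enough for their size, and
  a set that meets at least two of them meets at most a proportion of order
  \<open>(diam / wt)\<^sup>s\<close> of them.
  Sets meeting only one child are judged further down the tree.\<close>

definition balanced_branching ::
    "real \<Rightarrow> real \<Rightarrow> ('n \<Rightarrow> 'a::metric_space set) \<Rightarrow> ('n \<Rightarrow> real) \<Rightarrow> 'n \<Rightarrow> 'n set \<Rightarrow> bool" where
  "balanced_branching s c P wt u C \<longleftrightarrow>
     finite C \<and> C \<noteq> {} \<and> (\<forall>v\<in>C. P v \<subseteq> P u) \<and>
     (\<forall>v\<in>C. wt u powr s \<le> real (card C) * wt v powr s) \<and>
     (\<forall>V. bounded V \<longrightarrow> (\<exists>v\<in>C. \<exists>w\<in>C. v \<noteq> w \<and> V \<inter> P v \<noteq> {} \<and> V \<inter> P w \<noteq> {}) \<longrightarrow>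
        c * real (card {v\<in>C. V \<inter> P v \<noteq> {}}) * wt u powr s \<le> real (card C) * diameter V powr s)"

text \<open>A mass distribution principle without a measure. By induction, the members of the cover that
  meet a captured node have total \<open>s\<close>-th power of diameters at least \<open>c wt(u)\<^sup>s\<close>. The members are split
  into those that meet several children and those that meet just one. If the former meet a
  proportion \<open>p\<close> of the children, then they pay for the proportion \<open>p\<close> of the total. Each
  child in the remaining proportion \<open>1 - p\<close> is met only by members of its own, and pays by the
  induction hypothesis. The index set \<open>J\<close> makes the restriction to the members meeting a given
  child possible.\<close>

lemma captured_weight_bound:
  fixes P :: "'n \<Rightarrow> 'a::metric_space set"
  assumes "captured ch P V u" and "valid u" and "c > 0"
    and bdd: "\<And>i. bounded (V i)"
    and ch: "\<And>u. valid u \<Longrightarrow> balanced_branching s c P wt u (ch u) \<and> (\<forall>v\<in>ch u. valid v)"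
    and base: "\<And>u U. valid u \<Longrightarrow> bounded U \<Longrightarrow> P u \<subseteq> U \<Longrightarrow> c * wt u powr s \<le> diameter U powr s"
    and ne: "\<And>u. valid u \<Longrightarrow> P u \<noteq> {}"
    and J: "\<And>i. i \<notin> J \<Longrightarrow> V i \<inter> P u = {}"
  shows "\<exists>F\<subseteq>J. finite F \<and> c * wt u powr s \<le> (\<Sum>i\<in>F. diameter (V i) powr s)"
  using assms(1,2) J
proof (induction arbitrary: J rule: captured.induct)
  case (contained u i)
  then have "i \<in> J" using ne[of u] by blast
  then show ?case
    using base[OF \<open>valid u\<close> bdd contained(1)] by (intro exI[of _ "{i}"]) auto
next
  case (children u J)
  define C where "C = ch u"
  have bb: "balanced_branching s c P wt u C" and val: "\<And>v. v \<in> C \<Longrightarrow> valid v"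
    using ch[OF \<open>valid u\<close>] by (auto simp: C_def)
  have fin: "finite C" and "C \<noteq> {}" and sub: "\<And>v. v \<in> C \<Longrightarrow> P v \<subseteq> P u"
    and many: "\<And>v. v \<in> C \<Longrightarrow> wt u powr s \<le> real (card C) * wt v powr s"
    and spread: "\<And>U v w. \<lbrakk>bounded U; v \<in> C; w \<in> C; v \<noteq> w; U \<inter> P v \<noteq> {}; U \<inter> P w \<noteq> {}\<rbrakk> \<Longrightarrow>
        c * real (card {v\<in>C. U \<inter> P v \<noteq> {}}) * wt u powr s \<le> real (card C) * diameter U powr s"
    using bb unfolding balanced_branching_def by (simp_all, blast+)
  define n where "n = real (card C)"
  have "n > 0" using fin \<open>C \<noteq> {}\<close> by (simp add: n_def card_gt_0_iff)
  define K where "K = c * wt u powr s / n"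
  have "K \<ge> 0" using \<open>c > 0\<close> \<open>n > 0\<close> by (simp add: K_def)
  define met where "met i = {v\<in>C. V i \<inter> P v \<noteq> {}}" for i
  \<comment> \<open>The members that meet several children. For the set \<open>M\<close> of children met by them,
    finitely many of these members suffice.\<close>
  define big where "big i \<longleftrightarrow> i \<in> J \<and> (\<exists>v\<in>met i. \<exists>w\<in>met i. v \<noteq> w)" for i
  define M where "M = {v\<in>C. \<exists>i. big i \<and> v \<in> met i}"
  obtain pick where pick: "\<And>v. v \<in> M \<Longrightarrow> big (pick v) \<and> v \<in> met (pick v)"
    using bchoice[of M "\<lambda>v i. big i \<and> v \<in> met i"] by (auto simp: M_def)
  define B where "B = pick ` M"
  have finM: "finite M" and MC: "M \<subseteq> C" using fin by (auto simp: M_def)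
  have finB: "finite B" by (simp add: B_def finM)
  have bigB: "K * card (met i) \<le> diameter (V i) powr s" if "i \<in> B" for i
  proof -
    have "big i" using that pick by (auto simp: B_def)
    then obtain v w where "v \<in> met i" "w \<in> met i" "v \<noteq> w" by (auto simp: big_def)
    then have "c * real (card (met i)) * wt u powr s \<le> n * diameter (V i) powr s"
      using spread[OF bdd, of v w i] by (auto simp: met_def n_def)
    then show ?thesis using \<open>n > 0\<close> by (simp add: K_def field_simps)
  qed
  have "card M \<le> card (\<Union>i\<in>B. met i)"
  proof (rule card_mono)
    show "finite (\<Union>i\<in>B. met i)" using finB fin by (auto simp: met_def)
    show "M \<subseteq> (\<Union>i\<in>B. met i)" using pick by (auto simp: B_def)
  qed
  also have "\<dots> \<le> (\<Sum>i\<in>B. card (met i))" by (rule card_UN_le[OF finB])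
  finally have "real (card M) \<le> real (\<Sum>i\<in>B. card (met i))"
    by (rule of_nat_mono)
  then have "K * card M \<le> K * (\<Sum>i\<in>B. card (met i))"
    using \<open>K \<ge> 0\<close> by (rule mult_left_mono)
  also have "\<dots> = (\<Sum>i\<in>B. K * card (met i))" by (simp add: sum_distrib_left)
  also have "\<dots> \<le> (\<Sum>i\<in>B. diameter (V i) powr s)" by (rule sum_mono) (rule bigB)
  finally have sumB: "K * card M \<le> (\<Sum>i\<in>B. diameter (V i) powr s)" .
  define good where "good v F \<longleftrightarrow> F \<subseteq> {i\<in>J. v \<in> met i} \<and> finite F
      \<and> c * wt v powr s \<le> (\<Sum>i\<in>F. diameter (V i) powr s)" for v F
  have "\<exists>F. good v F"
    if "v \<in> C - M" for v
  proof -
    have "V i \<inter> P v = {}" if "i \<notin> {i\<in>J. v \<in> met i}" for i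
      using that children.prems(2)[of i] sub[of v] \<open>v \<in> C - M\<close> by (auto simp: met_def)
    then show ?thesis
      using children.IH[of v "{i\<in>J. v \<in> met i}"] val[of v] that by (simp add: C_def good_def)
  qed
  then obtain F where "\<And>v. v \<in> C - M \<Longrightarrow> good v (F v)"
    by metis
  then have FJ: "\<And>v i. v \<in> C - M \<Longrightarrow> i \<in> F v \<Longrightarrow> i \<in> J \<and> v \<in> met i"
    and finF: "\<And>v. v \<in> C - M \<Longrightarrow> finite (F v)"
    and FK: "\<And>v. v \<in> C - M \<Longrightarrow> c * wt v powr s \<le> (\<Sum>i\<in>F v. diameter (V i) powr s)"
    unfolding good_def by (blast, simp_all)
  have disj: "F v \<inter> F w = {}" if "v \<in> C - M" "w \<in> C - M" "v \<noteq> w" for v w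
  proof (rule ccontr)
    assume "F v \<inter> F w \<noteq> {}"
    then obtain i where "i \<in> F v" "i \<in> F w" by blast
    then have "i \<in> J" "v \<in> met i" "w \<in> met i"
      using FJ[OF that(1), of i] FJ[OF that(2), of i] by simp_all
    then have "v \<in> M" using that by (auto simp: M_def big_def)
    then show False using that by blast
  qed
  have disjB: "B \<inter> (\<Union>v\<in>C-M. F v) = {}"
  proof (rule ccontr)
    assume "B \<inter> (\<Union>v\<in>C-M. F v) \<noteq> {}"
    then obtain i v where "i \<in> B" "v \<in> C - M" "i \<in> F v" by blast
    then have "big i" "v \<in> met i" using FJ[of v i] pick by (auto simp: B_def)
    then show False using \<open>v \<in> C - M\<close> by (auto simp: M_def)
  qed
  have "K * card (C - M) = (\<Sum>v\<in>C-M. K)" by simp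
  also have "\<dots> \<le> (\<Sum>v\<in>C-M. \<Sum>i\<in>F v. diameter (V i) powr s)"
  proof (rule sum_mono)
    fix v assume v: "v \<in> C - M"
    have "K \<le> c * wt v powr s"
      using many[of v] v \<open>n > 0\<close> \<open>c > 0\<close> by (simp add: K_def n_def field_simps)
    then show "K \<le> (\<Sum>i\<in>F v. diameter (V i) powr s)" using FK[OF v] by linarith
  qed
  also have "\<dots> = (\<Sum>i\<in>(\<Union>v\<in>C-M. F v). diameter (V i) powr s)"
    using fin finF disj by (intro sum.UNION_disjoint[symmetric]) auto
  finally have sumF: "K * card (C - M) \<le> (\<Sum>i\<in>(\<Union>v\<in>C-M. F v). diameter (V i) powr s)" .
  have "c * wt u powr s = K * n" using \<open>n > 0\<close> by (simp add: K_def)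
  also have "n = card M + card (C - M)"
    using card_mono[OF fin MC] by (simp add: n_def card_Diff_subset[OF finM MC])
  finally have "c * wt u powr s = K * card M + K * card (C - M)" by (simp add: distrib_left)
  also have "\<dots> \<le> (\<Sum>i\<in>B. diameter (V i) powr s) + (\<Sum>i\<in>(\<Union>v\<in>C-M. F v). diameter (V i) powr s)"
    using sumB sumF by simp
  also have "\<dots> = (\<Sum>i\<in>B \<union> (\<Union>v\<in>C-M. F v). diameter (V i) powr s)"
    using finB fin finF disjB by (intro sum.union_disjoint[symmetric]) auto
  finally have "c * wt u powr s \<le> (\<Sum>i\<in>B \<union> (\<Union>v\<in>C-M. F v). diameter (V i) powr s)" .
  moreover have "B \<union> (\<Union>v\<in>C-M. F v) \<subseteq> J" 
    using FJ pick by (auto simp: B_def big_def)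
  moreover have "finite (B \<union> (\<Union>v\<in>C-M. F v))" using finB fin finF by auto
  ultimately show ?case by blast
qed

lemma diam_pow_mono_exponent:
  assumes "bounded U" "diameter U \<le> 1" "0 \<le> s'" "s' \<le> s" "0 < s"
  shows "diam_pow s U \<le> diam_pow s' U"
proof -
  have "diameter U \<ge> 0" using diameter_ge_0[OF assms(1)] .
  then have "diameter U powr s \<le> diameter U powr s'" "diameter U powr s \<le> 1"
    using assms by (auto intro!: powr_mono' powr_le1)
  then show ?thesis using assms by (auto simp: diam_pow_def ennreal_leI)
qed

text \<open>Below diameter 1 the premeasure decreases in the exponent, so a vanishing measure for a smaller
  exponent would force the measure for \<open>s\<close> to vanish as well.\<close>

lemma hausdorff_dim_geI:
  fixes A :: "'a::metric_space set"
  assumes "hausdorff_measure s A \<noteq> 0" "0 < s"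
  shows "ennreal s \<le> hausdorff_dim A"
  unfolding hausdorff_dim_def
proof (rule INF_greatest)
  fix s' assume s': "s' \<in> {s. 0 \<le> s \<and> hausdorff_measure s A = 0}"
  show "ennreal s \<le> ennreal s'"
  proof (rule ccontr)
    assume "\<not> ennreal s \<le> ennreal s'"
    then have "s' \<le> s" using ennreal_leI[of s s'] by (meson linorder_le_cases)
    have zero: "hausdorff_premeasure s' \<delta> A = 0" if "\<delta> > 0" for \<delta>
    proof -
      have "hausdorff_premeasure s' \<delta> A \<le> hausdorff_measure s' A"
        unfolding hausdorff_measure_def using that by (intro SUP_upper) auto
      then show ?thesis using s' by simp
    qed
    have small: "hausdorff_premeasure s (min \<delta> 1) A \<le> hausdorff_premeasure s' (min \<delta> 1) A" for \<delta>
      unfolding hausdorff_premeasure_def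
    proof (rule INF_mono)
      fix U :: "nat \<Rightarrow> 'a set"
      assume U: "U \<in> {U. A \<subseteq> \<Union> (range U) \<and> (\<forall>i. bounded (U i) \<and> diameter (U i) \<le> min \<delta> 1)}"
      have "(\<Sum>i. diam_pow s (U i)) \<le> (\<Sum>i. diam_pow s' (U i))"
        using U s' \<open>s' \<le> s\<close> \<open>0 < s\<close> by (intro suminf_le diam_pow_mono_exponent) auto
      then show "\<exists>W\<in>{U. A \<subseteq> \<Union> (range U) \<and> (\<forall>i. bounded (U i) \<and> diameter (U i) \<le> min \<delta> 1)}.
          (\<Sum>i. diam_pow s (W i)) \<le> (\<Sum>i. diam_pow s' (U i))"
        using U by blast
    qed
    have "hausdorff_premeasure s \<delta> A = 0" if "\<delta> > 0" for \<delta>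
    proof -
      have "hausdorff_premeasure s \<delta> A \<le> hausdorff_premeasure s (min \<delta> 1) A"
        unfolding hausdorff_premeasure_def by (rule INF_superset_mono) auto
      also have "\<dots> \<le> 0" using small[of \<delta>] zero[of "min \<delta> 1"] that by simp
      finally show ?thesis by simp
    qed
    then have "hausdorff_measure s A = 0"
      unfolding hausdorff_measure_def by (simp add: SUP_eq_const[of _ _ 0])
    then show False using assms by simp
  qed
qed

text \<open>Open covers are needed to apply compactness, at an arbitrarily small cost in the sum of
  diameters.\<close>

lemma open_enlargement:
  fixes U :: "'a::metric_space set"
  assumes "bounded U" "0 < s" "0 < e"
  obtains V where "open V" "bounded V" "U \<subseteq> V"
    "ennreal (diameter V powr s) \<le> diam_pow s U + ennreal e"
proof (cases "U = {}")
  case True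
  then show ?thesis using assms by (intro that[of "{}"]) (auto simp: diam_pow_def)
next
  case False
  define d where "d = diameter U"
  have "d \<ge> 0" using diameter_ge_0[OF assms(1)] by (simp add: d_def)
  have "((\<lambda>h. (d + 2 * h) powr s) \<longlongrightarrow> (d + 2 * 0) powr s) (at_right 0)"
    using \<open>d \<ge> 0\<close> \<open>0 < s\<close> by (intro tendsto_powr2 tendsto_intros) (auto simp: eventually_at_right_field intro!: exI[of _ 1])
  then have "\<forall>\<^sub>F h in at_right 0. (d + 2 * h) powr s < d powr s + e"
    using \<open>0 < e\<close> by (intro order_tendstoD) auto
  then obtain h where h: "0 < h" "(d + 2 * h) powr s < d powr s + e"
    by (metis (no_types, lifting) dense eventually_at_right_field)
  define V where "V = (\<Union>x\<in>U. ball x h)"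
  have close: "dist a b \<le> d + 2 * h" if "a \<in> V" "b \<in> V" for a b
  proof -
    obtain x y where xy: "x \<in> U" "y \<in> U" "dist x a < h" "dist y b < h"
      using \<open>a \<in> V\<close> \<open>b \<in> V\<close> by (auto simp: V_def)
    have "dist x y \<le> d" using diameter_bounded_bound[OF assms(1)] xy by (simp add: d_def)
    then show ?thesis using xy dist_triangle[of a b x] dist_triangle[of x b y] by (simp add: dist_commute)
  qed
  have "diameter V \<le> d + 2 * h"
  proof -
    have "V \<noteq> {}" using False h by (auto simp: V_def)
    then show ?thesis
      using close unfolding diameter_def by (auto intro!: cSUP_least)
  qed
  moreover have bV: "bounded V"
    unfolding bounded_def using close False h by (metis)
  ultimately have "diameter V powr s \<le> d powr s + e"
    using h \<open>0 < s\<close> powr_mono2[of s "diameter V" "d + 2 * h"] diameter_ge_0[OF bV] by linarith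
  then have "ennreal (diameter V powr s) \<le> diam_pow s U + ennreal e"
    using False \<open>0 < s\<close> \<open>0 < e\<close> by (simp add: diam_pow_def d_def ennreal_leI flip: ennreal_plus)
  then show ?thesis
    using h by (intro that[of V] bV) (auto simp: V_def)
qed

text \<open>If every branch of the tree shrinks to a point of \<open>E\<close>, then every open cover of \<open>E\<close> captures
  the starting node, and the weight bound applies to it.\<close>

theorem hausdorff_measure_pos_of_tree:
  fixes P :: "'n \<Rightarrow> 'a::metric_space set" and E :: "'a set"
  assumes "valid u0" "wt u0 > 0" "c > 0" "s > 0"
    and branching: "\<And>u. valid u \<Longrightarrow>
        \<exists>C. balanced_branching s c P wt u C \<and> (\<forall>v\<in>C. valid v \<and> step u v)"
    and base: "\<And>u U. valid u \<Longrightarrow> bounded U \<Longrightarrow> P u \<subseteq> U \<Longrightarrow> c * wt u powr s \<le> diameter U powr s"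
    and ne: "\<And>u. valid u \<Longrightarrow> P u \<noteq> {}"
    and limit: "\<And>\<sigma>. \<sigma> 0 = u0 \<Longrightarrow> (\<And>n. valid (\<sigma> n)) \<Longrightarrow> (\<And>n. step (\<sigma> n) (\<sigma> (Suc n))) \<Longrightarrow>
        \<exists>x\<in>E. \<forall>V. open V \<and> x \<in> V \<longrightarrow> (\<exists>n. P (\<sigma> n) \<subseteq> V)"
  shows "hausdorff_measure s E \<noteq> 0"
proof -
  define ch where "ch u = (SOME C. balanced_branching s c P wt u C \<and> (\<forall>v\<in>C. valid v \<and> step u v))" for u
  have ch: "balanced_branching s c P wt u (ch u) \<and> (\<forall>v\<in>ch u. valid v \<and> step u v)" if "valid u" for u
    unfolding ch_def by (rule someI_ex[OF branching[OF that]])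
  define w where "w = c * wt u0 powr s"
  have "w > 0" using assms by (simp add: w_def)
  have lower: "ennreal (w / 2) \<le> (\<Sum>i. diam_pow s (U i))"
    if cov: "E \<subseteq> (\<Union>i. U i)" and bdd: "\<And>i. bounded (U i)" for U :: "nat \<Rightarrow> 'a set"
  proof -
    define enlarges where "enlarges i V \<longleftrightarrow> open V \<and> bounded V \<and> U i \<subseteq> V \<and>
        ennreal (diameter V powr s) \<le> diam_pow s (U i) + ennreal (w / 2 * (1/2) ^ Suc i)" for i V
    have "\<exists>V. enlarges i V" for i
    proof -
      have "w / 2 * (1/2) ^ Suc i > 0" using \<open>w > 0\<close> by simp
      from open_enlargement[OF bdd[of i] \<open>s > 0\<close> this] show ?thesis
        unfolding enlarges_def by metis
    qed
    then obtain V where "\<And>i. enlarges i (V i)" by metis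
    then have V: "\<And>i. open (V i)" "\<And>i. bounded (V i)" "\<And>i. U i \<subseteq> V i"
        "\<And>i. ennreal (diameter (V i) powr s) \<le> diam_pow s (U i) + ennreal (w / 2 * (1/2) ^ Suc i)"
      unfolding enlarges_def by simp_all
    have "captured ch P V u0"
    proof (rule captured_if_limits_covered)
      fix \<sigma> assume \<sigma>: "\<sigma> 0 = u0" "\<And>n. \<sigma> (Suc n) \<in> ch (\<sigma> n)"
      have val: "valid (\<sigma> n)" for n
      proof (induction n)
        case 0
        then show ?case using \<sigma>(1) assms(1) by simp
      next
        case (Suc n)
        then show ?case using ch[OF Suc] \<sigma>(2)[of n] by simp
      qed
      have "step (\<sigma> n) (\<sigma> (Suc n))" for n using ch[OF val] \<sigma>(2)[of n] by simp
      from limit[of \<sigma>, OF \<sigma>(1) val this]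
      obtain x where x: "x \<in> E" "\<And>V. open V \<Longrightarrow> x \<in> V \<Longrightarrow> \<exists>n. P (\<sigma> n) \<subseteq> V"
        by auto
      then obtain i where "x \<in> V i" using cov V(3) by blast
      then show "\<exists>n i. P (\<sigma> n) \<subseteq> V i" using x(2)[OF V(1)] by blast
    qed
    then have "\<exists>F\<subseteq>UNIV. finite F \<and> w \<le> (\<Sum>i\<in>F. diameter (V i) powr s)"
      unfolding w_def
    proof (rule captured_weight_bound)
      show "balanced_branching s c P wt u (ch u) \<and> (\<forall>v\<in>ch u. valid v)" if "valid u" for u
        using ch[OF that] by simp
    qed (use assms(1,3) V(2) base ne in simp_all)
    then obtain F where F: "finite F" "w \<le> (\<Sum>i\<in>F. diameter (V i) powr s)"
      by auto
    have "ennreal w \<le> (\<Sum>i\<in>F. ennreal (diameter (V i) powr s))"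
      using F by (simp add: ennreal_leI)
    also have "\<dots> \<le> (\<Sum>i. ennreal (diameter (V i) powr s))"
      by (intro sum_le_suminf F) auto
    also have "\<dots> \<le> (\<Sum>i. diam_pow s (U i) + ennreal (w / 2 * (1/2) ^ Suc i))"
      by (intro suminf_le V) auto
    also have "\<dots> = (\<Sum>i. diam_pow s (U i)) + (\<Sum>i. ennreal (w / 2 * (1/2) ^ Suc i))"
      by (rule suminf_add[symmetric]) auto
    also have "(\<Sum>i. ennreal (w / 2 * (1/2) ^ Suc i)) = ennreal (w / 2)"
    proof -
      have "(\<lambda>i. w / 2 * (1/2) ^ Suc i) sums (w / 2 * 1)"
        by (intro sums_mult power_half_series)
      then show ?thesis using \<open>w > 0\<close> by (intro suminf_ennreal_eq) auto
    qed
    finally have "ennreal (w / 2) + ennreal (w / 2) \<le> (\<Sum>i. diam_pow s (U i)) + ennreal (w / 2)"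
      using \<open>w > 0\<close> ennreal_plus[of "w / 2" "w / 2"] by simp
    moreover have "a \<le> b" if "a + a \<le> b + a" "a \<noteq> top" for a b :: ennreal
      using that ennreal_add_left_cancel_le[of a a b] add.commute[of b a] by simp
    ultimately show ?thesis using ennreal_neq_top by blast
  qed
  have "ennreal (w / 2) \<le> hausdorff_premeasure s 1 E"
    unfolding hausdorff_premeasure_def by (rule INF_greatest) (use lower in auto)
  also have "\<dots> \<le> hausdorff_measure s E"
    unfolding hausdorff_measure_def by (intro SUP_upper) auto
  finally have "0 < hausdorff_measure s E"
    using \<open>w > 0\<close> by (metis ennreal_less_zero_iff half_gt_zero order_less_le_trans)
  then show ?thesis by simp
qed

section \<open>Distortion of univalent functions\<close>

text \<open>If the image contained the disc of radius 2, the inverse function would map that disc into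
  the unit disc and Cauchy's estimate would give it a derivative of at most \<open>1/2\<close> at 0.\<close>

lemma normalized_univalent_omits:
  assumes hol: "g holomorphic_on ball 0 1" and inj: "inj_on g (ball 0 1)" and d: "deriv g 0 = 1"
    and g0: "g 0 = (0::complex)"
  obtains w where "w \<notin> g ` ball 0 1" "norm w \<le> 2"
proof (rule ccontr)
  assume "\<not> thesis"
  then have sub: "cball 0 2 \<subseteq> g ` ball 0 1" using that by (meson mem_cball_0 subsetI)
  obtain h where h: "h holomorphic_on (g ` ball 0 1)"
     "\<And>z. z \<in> ball 0 1 \<Longrightarrow> deriv g z * deriv h (g z) = 1"
     "\<And>z. z \<in> ball 0 1 \<Longrightarrow> h (g z) = z"
    using holomorphic_has_inverse[OF hol open_ball inj] by metis
  have "norm (h w) \<le> 1" if "norm (0 - w) = 2" for w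
  proof -
    have "w \<in> g ` ball 0 1" using sub that by auto
    then show ?thesis using h(3) by force
  qed
  moreover have "h holomorphic_on ball 0 2" "continuous_on (cball 0 2) h"
    using h(1) sub holomorphic_on_subset holomorphic_on_imp_continuous_on
    by (meson ball_subset_cball subset_trans)+
  ultimately have "norm ((deriv ^^ 1) h 0) \<le> fact 1 * 1 / 2 ^ 1"
    by (intro Cauchy_inequality) auto
  moreover have "deriv h 0 = 1" using h(2)[of 0] d g0 by simp
  ultimately show False by simp
qed

text \<open>A weak form of Koebe's growth theorem, with an unspecified constant. If \<open>g\<close> omits \<open>w\<close>, then
  \<open>1 - g/w\<close> has a holomorphic square root \<open>h\<close> with \<open>h 0 = 1\<close>. This \<open>h\<close> omits 0, and it omits \<open>-1\<close> as
  well since \<open>g\<close> vanishes only at 0. So Schottky's theorem bounds \<open>h\<close>, and thereby \<open>g\<close>.\<close>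

lemma normalized_univalent_bounded:
  obtains C :: real where "C \<ge> 1"
    "\<And>g z. \<lbrakk>g holomorphic_on ball 0 1; inj_on g (ball 0 1); deriv g 0 = 1; g 0 = (0::complex); norm z \<le> 1/2\<rbrakk>
       \<Longrightarrow> norm (g z) \<le> C"
proof -
  define S where "S = exp (pi * exp (pi * (2 + 2 * 1 + 12 * (2/3) / (1 - 2/3))))"
  have *: "norm (g z) \<le> 2 * (1 + S^2)"
    if hol: "g holomorphic_on ball 0 1" and inj: "inj_on g (ball 0 1)" and d: "deriv g 0 = 1"
      and g0: "g 0 = 0" and z: "norm z \<le> 1/2" for g :: "complex \<Rightarrow> complex" and z
  proof -
    obtain w where w: "w \<notin> g ` ball 0 1" "norm w \<le> 2"
      using normalized_univalent_omits[OF hol inj d g0] .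
    have "w \<noteq> 0" using w(1) g0 by force
    have nz: "1 - g z / w \<noteq> 0" if "z \<in> ball 0 1" for z
      using w(1) that \<open>w \<noteq> 0\<close> by (auto simp: field_simps)
    have "(\<lambda>z. 1 - g z / w) holomorphic_on ball 0 1"
      using \<open>w \<noteq> 0\<close> by (intro holomorphic_intros hol)
    from holomorphic_logarithm_exists[OF convex_ball open_ball this nz, of 0]
    obtain L where L: "L holomorphic_on ball 0 1" "\<And>z. z \<in> ball 0 1 \<Longrightarrow> exp (L z) = 1 - g z / w"
      by auto
    define h where "h z = exp ((L z - L 0) / 2)" for z
    have holh: "h holomorphic_on ball 0 1"
      unfolding h_def by (intro holomorphic_intros L) auto
    have h2: "h z ^ 2 = 1 - g z / w" if "z \<in> ball 0 1" for z
    proof -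
      have "h z ^ 2 = exp (2 * ((L z - L 0) / 2))" unfolding h_def by (rule exp_double[symmetric])
      also have "2 * ((L z - L 0) / 2) = L z - L 0" by simp
      also have "exp (L z - L 0) = 1 - g z / w" using L(2)[OF that] L(2)[of 0] g0 by (simp add: exp_diff)
      finally show ?thesis .
    qed
    have "h 0 = 1" by (simp add: h_def)
    have hm1: "h z \<noteq> -1" if "z \<in> ball 0 1" for z
    proof
      assume "h z = -1"
      then have "g z = g 0" using h2[OF that] \<open>w \<noteq> 0\<close> g0 by simp
      then have "z = 0" using inj that by (auto dest: inj_onD)
      then show False using \<open>h z = -1\<close> \<open>h 0 = 1\<close> by simp
    qed
    \<comment> \<open>The sign moves the omitted value \<open>-1\<close> to 1, and the factor \<open>3/4\<close> makes \<open>F\<close> holomorphic on the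
      closed unit disc, as Schottky's theorem requires.\<close>
    define F where "F z = - h (3/4 * z)" for z
    have "(h \<circ> (\<lambda>z. 3/4 * z)) holomorphic_on cball 0 1"
      by (rule holomorphic_on_compose_gen[OF _ holh]) (auto intro!: holomorphic_intros simp: norm_mult)
    then have "F holomorphic_on cball 0 1"
      unfolding F_def o_def by (rule holomorphic_on_minus)
    moreover have "\<not> (F u = 0 \<or> F u = 1)" if "u \<in> cball 0 1" for u
    proof -
      have "3/4 * u \<in> ball 0 1" using that by (simp add: norm_mult)
      then show ?thesis using hm1[of "3/4 * u"] by (auto simp: F_def h_def minus_equation_iff)
    qed
    moreover have "norm (F 0) \<le> 1" using \<open>h 0 = 1\<close> by (simp add: F_def)
    moreover have "norm (4/3 * z) \<le> 2/3" using z by (simp add: norm_mult)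
    ultimately have "norm (F (4/3 * z)) \<le> S"
      unfolding S_def by (intro Schottky) auto
    then have "norm (h z) \<le> S" by (simp add: F_def)
    have zb: "z \<in> ball 0 1" using z by simp
    have "g z = w * (1 - h z ^ 2)" using h2[OF zb] \<open>w \<noteq> 0\<close> by (simp add: field_simps)
    then have "norm (g z) \<le> 2 * norm (1 - h z ^ 2)" using w(2) by (simp add: norm_mult mult_right_mono)
    also have "norm (1 - h z ^ 2) \<le> 1 + norm (h z) ^ 2" 
      by (metis norm_one norm_power norm_triangle_ineq4)
    also have "norm (h z) ^ 2 \<le> S ^ 2" using \<open>norm (h z) \<le> S\<close> by (simp add: power_mono)
    finally show ?thesis by simp
  qed
  show ?thesis
    by (rule that[of "2 * (1 + S^2)"]) (use * in auto)
qed

text \<open>A weak form of Koebe's distortion theorem: on a disc that is small compared with the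
  domain of univalence, the derivative stays close to its value at the centre. It follows from the bound above
  by Cauchy's estimate for the second derivative.\<close>

lemma univalent_deriv_distortion:
  obtains \<Lambda> :: real where "\<Lambda> \<ge> 2"
    "\<And>g a r x. \<lbrakk>0 < r; g holomorphic_on ball a (\<Lambda> * r); inj_on g (ball a (\<Lambda> * r)); x \<in> cball a r\<rbrakk>
       \<Longrightarrow> norm (deriv g x - deriv g a) \<le> norm (deriv g a) / 2"
proof -
  obtain C :: real where C: "C \<ge> 1"
    "\<And>g z. \<lbrakk>g holomorphic_on ball 0 1; inj_on g (ball 0 1); deriv g 0 = 1; g 0 = (0::complex); norm z \<le> 1/2\<rbrakk>
       \<Longrightarrow> norm (g z) \<le> C"
    using normalized_univalent_bounded by metis
  have norm_case: "norm (deriv g z - 1) \<le> 32 * C * norm z"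
    if hol: "g holomorphic_on ball 0 1" and inj: "inj_on g (ball 0 1)" and d: "deriv g 0 = 1"
      and g0: "g 0 = 0" and z: "norm z \<le> 1/4" for g :: "complex \<Rightarrow> complex" and z
  proof -
    have bd: "norm (deriv (deriv g) x) \<le> 32 * C" if "norm x \<le> 1/4" for x
    proof -
      have sub: "norm y \<le> 1/2" if "y \<in> cball x (1/4)" for y
        using that \<open>norm x \<le> 1/4\<close> norm_triangle_ineq2[of y x] by (simp add: dist_norm norm_minus_commute)
      then have sub': "cball x (1/4) \<subseteq> ball 0 1" by force
      have "norm ((deriv ^^ 2) g x) \<le> fact 2 * C / (1/4) ^ 2"
      proof (rule Cauchy_inequality)
        show "g holomorphic_on ball x (1/4)" 
          using hol sub' ball_subset_cball holomorphic_on_subset by blast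
        show "continuous_on (cball x (1/4)) g"
          using hol sub' holomorphic_on_imp_continuous_on holomorphic_on_subset by blast
        show "norm (g y) \<le> C" if "norm (x - y) = 1/4" for y
          using sub[of y] that C(2)[OF hol inj d g0] by (simp add: dist_norm)
      qed auto
      then show ?thesis by (simp add: power2_eq_square numeral_2_eq_2)
    qed
    have "norm (deriv g z - deriv g 0) \<le> 32 * C * norm (z - 0)"
    proof (rule field_differentiable_bound[of "cball 0 (1/4)"])
      fix x :: complex assume x: "x \<in> cball 0 (1/4)"
      have "deriv g holomorphic_on ball 0 1" using hol by (intro holomorphic_deriv) auto
      then have "(deriv g has_field_derivative deriv (deriv g) x) (at x)"
        using x by (intro holomorphic_derivI[of _ "ball 0 1"]) auto
      then show "(deriv g has_field_derivative deriv (deriv g) x) (at x within cball 0 (1/4))"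
        by (rule has_field_derivative_at_within)
    qed (use bd z in auto)
    then show ?thesis using d by simp
  qed
  define \<Lambda> where "\<Lambda> = 64 * C"
  have "\<Lambda> \<ge> 2" using C by (simp add: \<Lambda>_def)
  moreover have "norm (deriv g x - deriv g a) \<le> norm (deriv g a) / 2"
    if r: "0 < r" and hol: "g holomorphic_on ball a (\<Lambda> * r)" and inj: "inj_on g (ball a (\<Lambda> * r))"
      and x: "x \<in> cball a r" for g a r x
  proof -
    define R where "R = complex_of_real (\<Lambda> * r)"
    have "norm R = \<Lambda> * r" "\<Lambda> * r > 0" using r \<open>\<Lambda> \<ge> 2\<close> by (auto simp: R_def norm_mult)
    then have "R \<noteq> 0" by auto
    have in_ball: "a + R * z \<in> ball a (\<Lambda> * r)" if "z \<in> ball 0 1" for z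
      using mult_strict_left_mono[of "norm z" 1 "\<Lambda> * r"] that \<open>norm R = \<Lambda> * r\<close> \<open>\<Lambda> * r > 0\<close>
      by (simp add: dist_norm norm_mult)
    have "a \<in> ball a (\<Lambda> * r)" using \<open>\<Lambda> * r > 0\<close> by simp
    define D where "D = deriv g a"
    have "D \<noteq> 0"
      unfolding D_def using holomorphic_injective_imp_regular[OF hol open_ball inj] \<open>\<Lambda> * r > 0\<close> by simp
    \<comment> \<open>Koebe normalization of \<open>g\<close>.\<close>
    define k where "k z = (g (a + R * z) - g a) / (R * D)" for z
    have dk: "(k has_field_derivative deriv g (a + R * z) / D) (at z)" if "z \<in> ball 0 1" for z
    proof -
      have "(g has_field_derivative deriv g (a + R * z)) (at (a + R * z))"
        using in_ball[OF that] hol by (intro holomorphic_derivI[of _ "ball a (\<Lambda> * r)"]) auto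
      then have "((\<lambda>z. g (a + R * z)) has_field_derivative deriv g (a + R * z) * R) (at z)"
        by (rule DERIV_chain2) (auto intro!: derivative_eq_intros)
      from DERIV_cdivide[OF DERIV_diff[OF this DERIV_const[of "g a"]], of "R * D"]
      show ?thesis using \<open>R \<noteq> 0\<close> by (simp add: k_def[abs_def])
    qed
    have "k holomorphic_on ball 0 1"
      using dk by (intro holomorphic_onI) (meson field_differentiable_at_within field_differentiable_def)
    moreover have "inj_on k (ball 0 1)"
    proof (rule inj_onI)
      fix y z assume yz: "y \<in> ball 0 1" "z \<in> ball 0 1" "k y = k z"
      then have "g (a + R * y) = g (a + R * z)"
        using \<open>R \<noteq> 0\<close> \<open>D \<noteq> 0\<close> by (simp add: k_def)
      then have "a + R * y = a + R * z" using inj_onD[OF inj] in_ball yz by blast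
      then show "y = z" using \<open>R \<noteq> 0\<close> by simp
    qed
    moreover have "deriv k 0 = 1"
      using DERIV_imp_deriv[OF dk[of 0]] \<open>D \<noteq> 0\<close> by (simp add: D_def)
    moreover have "k 0 = 0" by (simp add: k_def)
    moreover define z where "z = (x - a) / R"
    have nz: "norm z \<le> 1 / \<Lambda>"
      using x r \<open>\<Lambda> \<ge> 2\<close> unfolding z_def norm_divide \<open>norm R = \<Lambda> * r\<close>
      by (simp add: dist_norm norm_minus_commute field_simps)
    have "1 / \<Lambda> \<le> 1/4" using C by (simp add: \<Lambda>_def field_simps)
    then have "norm z \<le> 1/4" using nz by simp
    ultimately have "norm (deriv k z - 1) \<le> 32 * C * norm z"
      by (intro norm_case)
    also have "\<dots> \<le> 32 * C * (1 / \<Lambda>)" using nz C by (intro mult_left_mono) auto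
    also have "\<dots> = 1/2" using C by (simp add: \<Lambda>_def)
    finally have "norm (deriv k z - 1) \<le> 1/2" .
    moreover have "deriv k z = deriv g x / D"
      using DERIV_imp_deriv[OF dk[of z]] \<open>norm z \<le> 1/4\<close> \<open>R \<noteq> 0\<close> by (simp add: z_def)
    ultimately have "norm ((deriv g x - D) / D) \<le> 1/2"
      using \<open>D \<noteq> 0\<close> by (simp add: diff_divide_distrib)
    then show ?thesis using \<open>D \<noteq> 0\<close> by (simp add: norm_divide D_def field_simps)
  qed
  ultimately show ?thesis by (rule that)
qed

text \<open>The mean value inequality for \<open>g\<close> minus its linear part. It gives both Lipschitz bounds
  at once, so that no separate covering theorem is required for the lower one.\<close>

lemma bilipschitz_of_deriv_distortion:
  fixes g :: "complex \<Rightarrow> complex"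
  assumes hol: "g holomorphic_on S" and S: "open S" "cball a r \<subseteq> S"
    and dist: "\<And>x. x \<in> cball a r \<Longrightarrow> norm (deriv g x - deriv g a) \<le> norm (deriv g a) / 2"
    and xy: "x \<in> cball a r" "y \<in> cball a r"
  shows "norm (g x - g y) \<le> 3/2 * norm (deriv g a) * norm (x - y)"
    and "1/2 * norm (deriv g a) * norm (x - y) \<le> norm (g x - g y)"
proof -
  define D where "D = deriv g a"
  have "norm ((g x - D * x) - (g y - D * y)) \<le> norm D / 2 * norm (x - y)"
  proof (rule field_differentiable_bound[of "cball a r"])
    fix z assume z: "z \<in> cball a r"
    have "(g has_field_derivative deriv g z) (at z)"
      using z S hol by (intro holomorphic_derivI) auto
    then have "((\<lambda>x. g x - D * x) has_field_derivative deriv g z - D) (at z)"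
      by (auto intro!: derivative_eq_intros)
    then show "((\<lambda>x. g x - D * x) has_field_derivative deriv g z - D) (at z within cball a r)"
      by (rule has_field_derivative_at_within)
    show "norm (deriv g z - D) \<le> norm D / 2" using dist[OF z] by (simp add: D_def)
  qed (use xy in auto)
  then have "norm ((g x - g y) - D * (x - y)) \<le> norm D / 2 * norm (x - y)"
    by (simp add: algebra_simps)
  then show "norm (g x - g y) \<le> 3/2 * norm (deriv g a) * norm (x - y)"
    and "1/2 * norm (deriv g a) * norm (x - y) \<le> norm (g x - g y)"
    using norm_triangle_ineq2[of "g x - g y" "D * (x - y)"]
      norm_triangle_ineq2[of "D * (x - y)" "g x - g y"]
    by (simp_all add: D_def norm_mult norm_minus_commute)
qed

text \<open>By Bloch's theorem the image of \<open>G\<close> contains a disc of radius proportional to \<open>r \<bar>G'(a)\<bar>\<close>. If its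
  radius exceeded \<open>\<pi>\<close>, the disc would contain two points that differ by \<open>2 \<pi> i\<close>.\<close>

lemma log_univalent_deriv_bound:
  assumes hol: "G holomorphic_on ball a r" and inj: "inj_on (\<lambda>z. exp (G z)) (ball a r)" and "0 < r"
  shows "r * norm (deriv G a) \<le> 12 * pi"
proof (rule ccontr)
  assume big: "\<not> ?thesis"
  define r' where "r' = r * norm (deriv G a) / 12"
  have "r' > pi" using big by (simp add: r'_def)
  obtain b where b: "ball b r' \<subseteq> G ` ball a r"
    using Bloch[OF hol \<open>0 < r\<close>, of r'] by (auto simp: r'_def)
  have "b - \<i> * pi \<in> ball b r'" "b + \<i> * pi \<in> ball b r'"
    using \<open>r' > pi\<close> by (auto simp: dist_norm norm_mult)
  then have "b - \<i> * pi \<in> G ` ball a r" "b + \<i> * pi \<in> G ` ball a r"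
    using b by (auto simp only: subsetD)
  then obtain x y where xy: "x \<in> ball a r" "y \<in> ball a r" "b - \<i> * pi = G x" "b + \<i> * pi = G y"
    by (auto simp only: image_iff)
  have "exp (b - \<i> * pi) = exp (b + \<i> * pi)"
    by (simp add: exp_add exp_diff)
  then have "x = y" using inj_onD[OF inj, of x y] xy by simp
  then have "b - \<i> * pi = b + \<i> * pi" using xy by simp
  then show False by (simp add: complex_eq_iff)
qed

section \<open>The logarithmic coordinate of a tract\<close>

text \<open>A continuous lift is locally the composition with a holomorphic inverse branch of the
  covering.\<close>

lemma holomorphic_lift_through_covering:
  assumes cov: "covering_space D f S" and "open D" "open S" and holf: "f holomorphic_on D"
    and "open U" and cont: "continuous_on U \<phi>" and im: "\<phi> ` U \<subseteq> D"
    and hol: "(\<lambda>z. f (\<phi> z)) holomorphic_on U"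
  shows "\<phi> holomorphic_on U"
  unfolding holomorphic_on_open[OF \<open>open U\<close>]
proof
  fix z0 assume z0: "z0 \<in> U"
  then have "\<phi> z0 \<in> D" using im by auto
  then have "f (\<phi> z0) \<in> S" using cov by (auto simp: covering_space_def)
  then obtain T v where T: "f (\<phi> z0) \<in> T" "openin (top_of_set S) T" "\<Union>v = D \<inter> f -` T"
     and v: "\<And>u. u \<in> v \<Longrightarrow> openin (top_of_set D) u" "\<And>u. u \<in> v \<Longrightarrow> \<exists>q. homeomorphism u T f q"
    using cov unfolding covering_space_def by meson
  obtain u where u: "u \<in> v" "\<phi> z0 \<in> u" using T \<open>\<phi> z0 \<in> D\<close> by blast
  obtain q where q: "homeomorphism u T f q" using v(2)[OF u(1)] by auto
  have "open u" "u \<subseteq> D" using v(1)[OF u(1)] \<open>open D\<close> by (auto simp: openin_open_eq)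
  have "inj_on f u" using q by (metis homeomorphism_def inj_on_inverseI)
  have "f holomorphic_on u" using holf \<open>u \<subseteq> D\<close> holomorphic_on_subset by blast
  then obtain g where g: "g holomorphic_on (f ` u)" "\<And>z. z \<in> u \<Longrightarrow> g (f z) = z"
    using holomorphic_has_inverse[OF _ \<open>open u\<close> \<open>inj_on f u\<close>] by metis
  define N where "N = U \<inter> \<phi> -` u"
  have "open N" unfolding N_def using continuous_open_preimage[OF cont \<open>open U\<close> \<open>open u\<close>] .
  have "z0 \<in> N" using z0 u by (simp add: N_def)
  have "((g \<circ> (\<lambda>z. f (\<phi> z)))) holomorphic_on N"
    using hol g(1) by (intro holomorphic_on_compose_gen[of _ _ _ "f ` u"])
      (auto simp: N_def intro: holomorphic_on_subset)
  moreover have "(g \<circ> (\<lambda>z. f (\<phi> z))) z = \<phi> z" if "z \<in> N" for z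
    using that g(2) by (simp add: N_def)
  ultimately have "\<phi> holomorphic_on N" by (metis (no_types, lifting) holomorphic_transform)
  then show "\<exists>f'. (\<phi> has_field_derivative f') (at z0)"
    using \<open>open N\<close> \<open>z0 \<in> N\<close> by (meson holomorphic_on_open)
qed

text \<open>A logarithm \<open>\<psi>\<close> of \<open>f\<close> on \<open>D\<close> inverts \<open>\<phi>\<close> up to a constant, because \<open>\<psi> \<circ> \<phi>\<close> and the identity are
  both lifts of \<open>exp\<close>.\<close>

lemma exp_lift_inj_on:
  assumes "simply_connected D" "open D" "continuous_on D f" "\<And>w. w \<in> D \<Longrightarrow> f w \<noteq> 0"
    and "connected U" "continuous_on U \<phi>" "\<phi> ` U \<subseteq> D"
    and lift: "\<And>z. z \<in> U \<Longrightarrow> f (\<phi> z) = exp z"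
  shows "inj_on (\<phi> :: complex \<Rightarrow> complex) U"
proof -
  obtain \<psi> where \<psi>: "continuous_on D \<psi>" "\<And>w. w \<in> D \<Longrightarrow> f w = exp (\<psi> w)"
    using continuous_logarithm_on_simply_connected assms(1-4) open_imp_locally_path_connected by metis
  define h where "h z = \<psi> (\<phi> z) - z" for z
  have conth: "continuous_on U h"
    unfolding h_def
    using continuous_on_compose2[OF \<psi>(1) assms(6,7)] by (intro continuous_intros)
  have one: "exp (h z) = 1" if "z \<in> U" for z
  proof -
    have "\<phi> z \<in> D" using that assms(7) by auto
    then have "exp (\<psi> (\<phi> z)) = exp z" using \<psi>(2) lift[OF that] by metis
    then show ?thesis by (simp add: h_def exp_diff)
  qed
  have "h constant_on U"
  proof (rule continuous_discrete_range_constant[OF \<open>connected U\<close> conth])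
    fix x assume "x \<in> U"
    have "2 * pi \<le> norm (h y - h x)" if y: "y \<in> U" "h y \<noteq> h x" for y
    proof -
      have "exp (h y - h x) = 1" using one \<open>x \<in> U\<close> y(1) by (simp add: exp_diff)
      then obtain n where n: "Re (h y - h x) = 0" "Im (h y - h x) = of_int (2 * n) * pi"
        using exp_eq_1 by metis
      then have "n \<noteq> 0" using y(2) by (auto simp: complex_eq_iff)
      then have "1 \<le> \<bar>real_of_int n\<bar>" by linarith
      then have "2 * pi \<le> \<bar>Im (h y - h x)\<bar>" using n(2) by (simp add: abs_mult)
      then show ?thesis using abs_Im_le_cmod order_trans by blast
    qed
    then show "\<exists>e>0. \<forall>y. y \<in> U \<and> h y \<noteq> h x \<longrightarrow> e \<le> norm (h y - h x)"
      by (intro exI[of _ "2 * pi"]) auto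
  qed
  then obtain c where "\<And>z. z \<in> U \<Longrightarrow> h z = c" by (auto simp: constant_on_def)
  then have c: "z = \<psi> (\<phi> z) - c" if "z \<in> U" for z using that by (simp add: h_def algebra_simps)
  show ?thesis by (rule inj_onI) (metis c)
qed

text \<open>The map \<open>\<phi>\<close> is the lift of \<open>exp\<close> through \<open>f\<close>, and \<open>G\<close> is its logarithm. The half-plane has to be
  shrunk first such that \<open>\<phi>\<close> avoids 0: where \<open>\<phi>\<close> vanishes, \<open>\<bar>f 0\<bar> = exp (Re z)\<close>.\<close>

lemma tract_log_coordinate:
  assumes cov: "covering_space D f (Delta R)" and R: "R > 0" and sc: "simply_connected D"
    and D: "open D" and holf: "f holomorphic_on D"
  obtains \<rho> G where "\<rho> > 0" "G holomorphic_on {z. Re z > \<rho>}"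
    "inj_on (\<lambda>z. exp (G z)) {z. Re z > \<rho>}"
    "\<And>z. Re z > \<rho> \<Longrightarrow> exp (G z) \<in> D" "\<And>z. Re z > \<rho> \<Longrightarrow> f (exp (G z)) = exp z"
proof -
  define H where "H \<rho> = {z. Re z > \<rho>}" for \<rho>
  have H: "open (H \<rho>)" "convex (H \<rho>)" for \<rho>
    by (auto simp: H_def open_halfspace_Re_gt convex_halfspace_Re_gt)
  have "exp \<in> H (ln R) \<rightarrow> Delta R"
    using R by (auto simp: H_def Delta_def) (metis exp_less_cancel_iff exp_ln)
  moreover have "continuous_on (H (ln R)) (exp :: complex \<Rightarrow> complex)"
    by (intro continuous_intros)
  ultimately obtain \<phi> where \<phi>: "continuous_on (H (ln R)) \<phi>" "\<phi> \<in> H (ln R) \<rightarrow> D"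
      "\<And>z. z \<in> H (ln R) \<Longrightarrow> f (\<phi> z) = exp z"
    using covering_space_lift[OF cov convex_imp_simply_connected[OF H(2)]
        open_imp_locally_path_connected[OF H(1)]] by metis
  have im: "\<phi> ` H (ln R) \<subseteq> D" using \<phi>(2) by auto
  have "open (Delta R)"
    unfolding Delta_def by (intro open_Collect_less continuous_intros)
  have "(\<lambda>z. f (\<phi> z)) holomorphic_on H (ln R)"
    using \<phi>(3) by (simp cong: holomorphic_cong) (intro holomorphic_intros)
  then have hol\<phi>: "\<phi> holomorphic_on H (ln R)"
    by (intro holomorphic_lift_through_covering[OF cov D \<open>open (Delta R)\<close> holf H(1) \<phi>(1) im])
  have "f w \<noteq> 0" if "w \<in> D" for w
  proof -
    have "f w \<in> Delta R" using cov that by (auto simp: covering_space_def)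
    then show ?thesis using R by (auto simp: Delta_def)
  qed
  then have inj\<phi>: "inj_on \<phi> (H (ln R))"
    using holomorphic_on_imp_continuous_on[OF holf] \<phi> im sc D convex_connected[OF H(2)]
    by (intro exp_lift_inj_on[of D f]) auto
  define \<rho> where "\<rho> = max 1 (max (ln R) (ln (norm (f 0) + 1)))"
  have sub: "H \<rho> \<subseteq> H (ln R)" by (auto simp: H_def \<rho>_def)
  have nz: "\<phi> z \<noteq> 0" if "z \<in> H \<rho>" for z
  proof
    assume "\<phi> z = 0"
    then have "norm (f 0) = exp (Re z)" using \<phi>(3)[of z] that sub by auto
    moreover have "Re z > ln (norm (f 0) + 1)" using that by (auto simp: H_def \<rho>_def)
    then have "exp (Re z) > norm (f 0) + 1"
      by (metis exp_less_cancel_iff exp_ln add_nonneg_pos norm_ge_zero zero_less_one)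
    ultimately show False by simp
  qed
  have "of_real (\<rho> + 1) \<in> H \<rho>" by (simp add: H_def)
  then obtain G where G: "G holomorphic_on H \<rho>" "\<And>z. z \<in> H \<rho> \<Longrightarrow> exp (G z) = \<phi> z"
    using holomorphic_logarithm_exists[OF H(2,1) holomorphic_on_subset[OF hol\<phi> sub] nz] by metis
  show ?thesis
  proof (rule that[of \<rho> G])
    show "inj_on (\<lambda>z. exp (G z)) {z. Re z > \<rho>}"
      using inj_on_subset[OF inj\<phi> sub] G(2) by (simp add: H_def inj_on_def)
  qed (use G \<phi> sub im in \<open>auto simp: H_def \<rho>_def\<close>)
qed

text \<open>Continuity on the closure of \<open>D\<close> bounds \<open>f\<close> on bounded parts of \<open>D\<close>. As \<open>\<bar>f\<bar> = exp x\<close> at the point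
  \<open>exp (G x)\<close>, this point lies outside any given disc once \<open>x\<close> is large, and the growth
  assumption applies there.\<close>

lemma tract_growth_in_log_coordinate:
  fixes f :: "complex \<Rightarrow> complex"
  assumes cont: "continuous_on (closure D) f"
    and G: "\<And>z. Re z > \<rho> \<Longrightarrow> exp (G z) \<in> D" "\<And>z. Re z > \<rho> \<Longrightarrow> f (exp (G z)) = exp z"
    and growth: "\<exists>r>0. \<forall>z\<in>D. cmod z \<ge> r \<longrightarrow> cmod (f z) \<le> exp (exp ((ln (cmod z)) powr p))"
  obtains T where "T > \<rho>" "T \<ge> 1"
    "\<And>x::real. x \<ge> T \<Longrightarrow> Re (G x) \<ge> 1 \<and> ln x \<le> Re (G x) powr p"
proof -
  obtain r where r: "r > 0" "\<And>z. z \<in> D \<Longrightarrow> cmod z \<ge> r \<Longrightarrow> cmod (f z) \<le> exp (exp ((ln (cmod z)) powr p))"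
    using growth by blast
  define r' where "r' = max r (exp 1)"
  have "compact (f ` (closure D \<inter> cball 0 r'))"
    by (intro compact_continuous_image continuous_on_subset[OF cont]) (auto intro: closed_Int_compact)
  then obtain M where M: "\<And>z. z \<in> closure D \<Longrightarrow> norm z \<le> r' \<Longrightarrow> norm (f z) \<le> M" "M > 0"
    using compact_imp_bounded bounded_pos by (metis (no_types, lifting) IntI imageI mem_cball_0)
  define T where "T = max 1 (max (\<rho> + 1) (ln M + 1))"
  show ?thesis
  proof (rule that[of T])
    fix x :: real assume x: "x \<ge> T"
    define z where "z = exp (G x)"
    have "Re (of_real x) > \<rho>" using x by (simp add: T_def)
    then have zD: "z \<in> D" and fz: "norm (f z) = exp x" using G by (auto simp: z_def)
    have "x > ln M" using x by (simp add: T_def)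
    then have "exp x > M" using M(2) by (metis exp_less_cancel_iff exp_ln)
    then have "norm z > r'" using M(1)[of z] zD fz closure_subset by force
    have norm_z: "ln (norm z) = Re (G x)" by (simp add: z_def)
    have "norm z \<ge> exp 1" using \<open>norm z > r'\<close> by (simp add: r'_def)
    then have "Re (G x) \<ge> 1" by (simp add: z_def)
    moreover have "exp x \<le> exp (exp (Re (G x) powr p))"
      using r(2)[OF zD] \<open>norm z > r'\<close> fz norm_z by (simp add: r'_def)
    then have "x \<le> exp (Re (G x) powr p)" by simp
    then have "ln x \<le> Re (G x) powr p"
      using x by (metis T_def exp_le_cancel_iff exp_ln max.bounded_iff order_less_le_trans zero_less_one)
    ultimately show "Re (G x) \<ge> 1 \<and> ln x \<le> Re (G x) powr p" ..
  qed (auto simp: T_def)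
qed

lemma escaping_if_backward_orbit_tends_to_infinity:
  fixes f :: "complex \<Rightarrow> complex"
  assumes G: "\<And>z. Re z > \<rho> \<Longrightarrow> exp (G z) \<in> D" "\<And>z. Re z > \<rho> \<Longrightarrow> f (exp (G z)) = exp z"
    and \<zeta>: "\<And>n. Re (\<zeta> n) > \<rho>" "\<And>n. exp (\<zeta> n) = exp (G (\<zeta> (Suc n)))"
    and lim: "filterlim (\<lambda>n. Re (\<zeta> n)) at_top sequentially"
  shows "exp (G (\<zeta> 0)) \<in> escaping_set f D"
proof -
  have orbit: "(f ^^ n) (exp (G (\<zeta> 0))) = exp (G (\<zeta> n))" for n
    by (induction n) (simp_all add: G \<zeta>)
  have "filterlim (\<lambda>n. exp (Re (\<zeta> n))) at_top sequentially"
    by (rule filterlim_compose[OF exp_at_top lim])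
  then have "filterlim (\<lambda>n. norm (exp (G (\<zeta> (Suc n))))) at_top sequentially"
    by (simp flip: \<zeta>(2))
  then have "filterlim (\<lambda>n. exp (G (\<zeta> (Suc n)))) at_infinity sequentially"
    by (simp add: filterlim_at_infinity_conv_norm_at_top)
  then have "filterlim (\<lambda>n. exp (G (\<zeta> n))) at_infinity sequentially"
    using filterlim_sequentially_Suc[of "\<lambda>n. exp (G (\<zeta> n))"] by simp
  then show ?thesis
    using G(1) \<zeta>(1) by (simp add: escaping_set_def orbit)
qed

section \<open>Slow crossings and lattice counting\<close>

text \<open>Take for \<open>\<beta>\<close> the first time at which \<open>u\<close> reaches \<open>y\<close>, and for \<open>\<alpha>\<close> the last time before it at which
  \<open>u\<close> is at most \<open>x\<close>.\<close>

lemma interval_crossing: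
  fixes u :: "real \<Rightarrow> real"
  assumes cont: "continuous_on {A..B} u" and "A \<le> B" "u A \<le> x" "x < y" "y \<le> u B"
  obtains \<alpha> \<beta> where "A \<le> \<alpha>" "\<alpha> < \<beta>" "\<beta> \<le> B" "u \<alpha> = x" "u \<beta> = y"
    "\<And>v. v \<in> {\<alpha>..\<beta>} \<Longrightarrow> x \<le> u v \<and> u v \<le> y"
proof -
  define above where "above = {A..B} \<inter> u -` {y..}"
  have "compact above" "B \<in> above"
    using continuous_closed_preimage[OF cont] assms
    by (auto simp: above_def compact_eq_bounded_closed bounded_Int)
  then obtain \<beta> where \<beta>: "\<beta> \<in> above" "\<And>v. v \<in> above \<Longrightarrow> \<beta> \<le> v"
    using compact_attains_inf[of above] by blast
  have "A \<le> \<beta>" "\<beta> \<le> B" "y \<le> u \<beta>" using \<beta>(1) by (auto simp: above_def)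
  have before: "u v < y" if "A \<le> v" "v < \<beta>" for v
    using \<beta>(2)[of v] that \<open>\<beta> \<le> B\<close> by (force simp: above_def)
  have cont\<beta>: "continuous_on {A..\<beta>} u" using cont \<open>\<beta> \<le> B\<close> by (auto intro: continuous_on_subset)
  have "u \<beta> = y"
  proof -
    obtain v where "A \<le> v" "v \<le> \<beta>" "u v = y"
      using IVT'[of u A y \<beta>] \<open>A \<le> \<beta>\<close> \<open>y \<le> u \<beta>\<close> assms(3,4) cont\<beta> by auto
    then show ?thesis using before[of v] by (cases "v = \<beta>") auto
  qed
  define below where "below = {A..\<beta>} \<inter> u -` {..x}"
  have "compact below" "A \<in> below"
    using continuous_closed_preimage[OF cont\<beta>] assms \<open>A \<le> \<beta>\<close>
    by (auto simp: below_def compact_eq_bounded_closed bounded_Int)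
  then obtain \<alpha> where \<alpha>: "\<alpha> \<in> below" "\<And>v. v \<in> below \<Longrightarrow> v \<le> \<alpha>"
    using compact_attains_sup[of below] by blast
  have "A \<le> \<alpha>" "\<alpha> \<le> \<beta>" "u \<alpha> \<le> x" using \<alpha>(1) by (auto simp: below_def)
  have after: "x < u v" if "\<alpha> < v" "v \<le> \<beta>" for v
    using \<alpha>(2)[of v] that \<open>A \<le> \<alpha>\<close> by (force simp: below_def)
  have "u \<alpha> = x"
  proof -
    have "continuous_on {\<alpha>..\<beta>} u" using cont\<beta> \<open>A \<le> \<alpha>\<close> by (auto intro: continuous_on_subset)
    then obtain v where "\<alpha> \<le> v" "v \<le> \<beta>" "u v = x"
      using IVT'[of u \<alpha> x \<beta>] \<open>\<alpha> \<le> \<beta>\<close> \<open>u \<alpha> \<le> x\<close> \<open>u \<beta> = y\<close> assms(4) by auto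
    then show ?thesis using after[of v] by (cases "v = \<alpha>") auto
  qed
  show ?thesis
  proof (rule that[of \<alpha> \<beta>])
    show "\<alpha> < \<beta>" using \<open>\<alpha> \<le> \<beta>\<close> \<open>u \<alpha> = x\<close> \<open>u \<beta> = y\<close> \<open>x < y\<close> by (cases "\<alpha> = \<beta>") auto
    show "x \<le> u v \<and> u v \<le> y" if "v \<in> {\<alpha>..\<beta>}" for v
      using that after[of v] before[of v] \<open>u \<alpha> = x\<close> \<open>u \<beta> = y\<close> \<open>A \<le> \<alpha>\<close>
      by (cases "v = \<alpha>"; cases "v = \<beta>") auto
  qed fact+
qed

lemma sum_lengths_disjoint_intervals_le:
  fixes \<alpha> \<beta> :: "'i \<Rightarrow> real"
  assumes "finite I" and le: "\<And>i. i \<in> I \<Longrightarrow> A \<le> \<alpha> i \<and> \<alpha> i \<le> \<beta> i \<and> \<beta> i \<le> B"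
    and disj: "disjoint_family_on (\<lambda>i. {\<alpha> i..\<beta> i}) I" and "A \<le> B"
  shows "(\<Sum>i\<in>I. \<beta> i - \<alpha> i) \<le> B - A"
proof -
  have "ennreal (\<Sum>i\<in>I. \<beta> i - \<alpha> i) = (\<Sum>i\<in>I. ennreal (\<beta> i - \<alpha> i))"
    using le by (intro sum_ennreal[symmetric]) auto
  also have "\<dots> = (\<Sum>i\<in>I. emeasure lborel {\<alpha> i..\<beta> i})"
    using le by (intro sum.cong) auto
  also have "\<dots> = emeasure lborel (\<Union>i\<in>I. {\<alpha> i..\<beta> i})"
    using disj \<open>finite I\<close> by (intro sum_emeasure) auto
  also have "\<dots> \<le> emeasure lborel {A..B}"
    using le by (intro emeasure_mono) fastforce+
  finally show ?thesis using \<open>A \<le> B\<close> by simp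
qed

text \<open>The crossings of different cells take place in disjoint intervals, whose lengths add up to at most
  \<open>B - A\<close>. So at least half of the crossings take time at most 1, and the mean value theorem gives
  a point with derivative at least \<open>h\<close> on each of these. The cells have length \<open>h\<close> and are separated by gaps
  of length \<open>h\<close>, which makes the selected values \<open>h\<close>-separated.\<close>

lemma many_slow_crossings:
  fixes u :: "real \<Rightarrow> real"
  assumes deriv: "\<And>v. v \<in> {A..B} \<Longrightarrow> (u has_real_derivative u' v) (at v)"
    and "A \<le> B" "u A \<le> t" "t + 2 * h * real M \<le> u B" "0 < h" and short: "2 * (B - A) \<le> real M"
  obtains S where "S \<subseteq> {..<M}" "M \<le> 2 * card S"
    "\<And>m. m \<in> S \<Longrightarrow> \<exists>v\<in>{A..B}. t + 2 * h * real m \<le> u v \<and> u v \<le> t + 2 * h * real m + h \<and> h \<le> u' v"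
proof -
  have cont: "continuous_on {A..B} u"
    using deriv DERIV_isCont by (intro continuous_at_imp_continuous_on) blast
  define crosses where "crosses m I \<longleftrightarrow> (case I of (\<alpha>, \<beta>) \<Rightarrow> A \<le> \<alpha> \<and> \<alpha> < \<beta> \<and> \<beta> \<le> B \<and>
      u \<alpha> = t + 2 * h * real m \<and> u \<beta> = t + 2 * h * real m + h \<and>
      (\<forall>v\<in>{\<alpha>..\<beta>}. t + 2 * h * real m \<le> u v \<and> u v \<le> t + 2 * h * real m + h))" for m I
  have "\<exists>I. crosses m I" if "m < M" for m
  proof -
    have "h * (2 * (real m + 1)) \<le> h * (2 * real M)" using that \<open>0 < h\<close> by (intro mult_left_mono) auto
    then have le: "t + 2 * h * real m + h \<le> u B" using assms(4,5) by (simp add: algebra_simps)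
    have "0 \<le> h * real m" using \<open>0 < h\<close> by simp
    then have ge: "u A \<le> t + 2 * h * real m" using assms(3) by linarith
    have "t + 2 * h * real m < t + 2 * h * real m + h" using \<open>0 < h\<close> by simp
    from interval_crossing[OF cont \<open>A \<le> B\<close> ge this le]
    obtain \<alpha> \<beta> where "A \<le> \<alpha>" "\<alpha> < \<beta>" "\<beta> \<le> B" "u \<alpha> = t + 2 * h * real m" "u \<beta> = t + 2 * h * real m + h"
      "\<And>v. v \<in> {\<alpha>..\<beta>} \<Longrightarrow> t + 2 * h * real m \<le> u v \<and> u v \<le> t + 2 * h * real m + h"
      by metis
    then show ?thesis by (intro exI[of _ "(\<alpha>, \<beta>)"]) (simp add: crosses_def)
  qed
  then obtain I where I: "\<And>m. m < M \<Longrightarrow> crosses m (I m)" by metis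
  define \<alpha> \<beta> where "\<alpha> m = fst (I m)" and "\<beta> m = snd (I m)" for m
  have I': "A \<le> \<alpha> m" "\<alpha> m < \<beta> m" "\<beta> m \<le> B" "u (\<alpha> m) = t + 2 * h * real m"
      "u (\<beta> m) = t + 2 * h * real m + h"
      "\<And>v. v \<in> {\<alpha> m..\<beta> m} \<Longrightarrow> t + 2 * h * real m \<le> u v \<and> u v \<le> t + 2 * h * real m + h" if "m < M" for m
    using I[OF that] by (auto simp: crosses_def \<alpha>_def \<beta>_def split: prod.splits)
  define S where "S = {m\<in>{..<M}. \<beta> m - \<alpha> m \<le> 1}"
  have lt: "u v < u w" if "m < n" "n < M" "v \<in> {\<alpha> m..\<beta> m}" "w \<in> {\<alpha> n..\<beta> n}" for m n v w
  proof -
    have "u v \<le> t + 2 * h * real m + h" using I'(6)[of m v] that by simp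
    also have "\<dots> < t + 2 * h * (real m + 1)" using \<open>0 < h\<close> by (simp add: algebra_simps)
    also have "\<dots> \<le> t + 2 * h * real n" using that \<open>0 < h\<close> by simp
    also have "\<dots> \<le> u w" using I'(6)[of n w] that by simp
    finally show ?thesis .
  qed
  have disj: "disjoint_family_on (\<lambda>i. {\<alpha> i..\<beta> i}) ({..<M} - S)"
    unfolding disjoint_family_on_def
  proof (intro ballI impI)
    fix m n assume mn: "m \<in> {..<M} - S" "n \<in> {..<M} - S" "m \<noteq> n"
    show "{\<alpha> m..\<beta> m} \<inter> {\<alpha> n..\<beta> n} = {}"
    proof (rule ccontr)
      assume "{\<alpha> m..\<beta> m} \<inter> {\<alpha> n..\<beta> n} \<noteq> {}"
      then obtain v where "v \<in> {\<alpha> m..\<beta> m}" "v \<in> {\<alpha> n..\<beta> n}" by blast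
      then show False using lt[of m n v v] lt[of n m v v] mn by (cases "m < n") auto
    qed
  qed
  have "real (card ({..<M} - S)) = (\<Sum>m\<in>{..<M} - S. 1)" by simp
  also have "\<dots> \<le> (\<Sum>m\<in>{..<M} - S. \<beta> m - \<alpha> m)"
    by (intro sum_mono) (auto simp: S_def)
  also have "\<dots> \<le> B - A"
    using I' disj \<open>A \<le> B\<close> by (intro sum_lengths_disjoint_intervals_le) (auto intro: less_imp_le)
  finally have bad: "real (card ({..<M} - S)) \<le> B - A" .
  have "2 * real (card ({..<M} - S)) \<le> real M"
    using order_trans[OF mult_left_mono[OF bad, of 2] short] by simp
  moreover have "card ({..<M} - S) = M - card S" "card S \<le> M"
    using card_Diff_subset[of S "{..<M}"] card_mono[of "{..<M}" S] by (auto simp: S_def)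
  ultimately have "M \<le> 2 * card S" by linarith
  moreover have "\<exists>v\<in>{A..B}. t + 2 * h * real m \<le> u v \<and> u v \<le> t + 2 * h * real m + h \<and> h \<le> u' v"
    if "m \<in> S" for m
  proof -
    have m: "m < M" "\<beta> m - \<alpha> m \<le> 1" using that by (auto simp: S_def)
    have "(u has_real_derivative u' v) (at v)" if "\<alpha> m \<le> v" "v \<le> \<beta> m" for v
      using deriv[of v] I'(1,3)[OF m(1)] that by auto
    then obtain v where v: "\<alpha> m < v" "v < \<beta> m" "u (\<beta> m) - u (\<alpha> m) = (\<beta> m - \<alpha> m) * u' v"
      using MVT2[OF I'(2)[OF m(1)], of u u'] by blast
    then have eq: "h = (\<beta> m - \<alpha> m) * u' v" using I'(4,5)[OF m(1)] by simp
    then have "u' v \<ge> 0" using \<open>0 < h\<close> v by (smt (verit) mult_nonneg_nonpos)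
    then have "h \<le> 1 * u' v" unfolding eq using m(2) by (intro mult_right_mono) auto
    then show ?thesis using v I'(6)[OF m(1), of v] I'(1,3)[OF m(1)] by (intro bexI[of _ v]) auto
  qed
  ultimately show ?thesis by (intro that[of S]) (auto simp: S_def)
qed

lemma card_nat_set_le:
  assumes "finite A" and diff: "\<And>x y. x \<in> A \<Longrightarrow> y \<in> A \<Longrightarrow> real x - real y \<le> a" and "a \<ge> 0"
  shows "real (card A) \<le> a + 1"
proof (cases "A = {}")
  case False
  have "A \<subseteq> {Min A..Min A + nat \<lfloor>a\<rfloor>}"
  proof
    fix x assume "x \<in> A"
    then have "real x - real (Min A) \<le> a" using diff Min_in[OF \<open>finite A\<close> False] by blast
    then have "int x - int (Min A) \<le> \<lfloor>a\<rfloor>" by (simp add: le_floor_iff)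
    then show "x \<in> {Min A..Min A + nat \<lfloor>a\<rfloor>}" using Min_le[OF \<open>finite A\<close> \<open>x \<in> A\<close>] by auto
  qed
  then have "card A \<le> nat \<lfloor>a\<rfloor> + 1" using card_mono[of "{Min A..Min A + nat \<lfloor>a\<rfloor>}" A] by simp
  then show ?thesis using \<open>a \<ge> 0\<close> by linarith
qed (use assms in auto)

text \<open>The numerical core of the spread condition. The quantities are the radius \<open>r\<close> of a disc, the
  horizontal spacing \<open>h\<close> of the lattice, the number \<open>N\<close> of its points, and the number \<open>n\<close> of those that a
  set of diameter \<open>d\<close> may meet. When \<open>d < r\<close>, both terms of \<open>d + 3\<close> are bounded by \<open>r\<^bsup>2-s\<^esup> d\<^bsup>s-1\<^esup>\<close>: the term \<open>d\<close> as \<open>s \<le> 2\<close>,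
  and the term \<open>3\<close> by the assumption \<open>key\<close>, as \<open>d\<close> is at least \<open>h/2\<close>.\<close>

lemma spread_estimate:
  fixes r h d s n N :: real
  assumes pos: "0 < r" "0 < h" "0 < d" "0 \<le> n" and s: "1 < s" "s < 2" and "h \<le> 2 * d"
    and key: "6 \<le> r powr (2 - s) * h powr (s - 1)"
    and "n \<le> N" and n: "n \<le> 5 * (d / h) * (d + 3)" and N: "r\<^sup>2 / (512 * pi * h) \<le> N"
  shows "1 / (20480 * pi) * n * r powr s \<le> N * (d / 2) powr s"
proof -
  have half: "(1/2 :: real) powr s \<ge> 1/4"
  proof -
    have "(1/2 :: real) powr 2 \<le> (1/2) powr s" using s by (intro powr_mono') auto
    then show ?thesis by (simp add: power2_eq_square)
  qed
  have d2: "(d / 2) powr s = (1/2) powr s * d powr s"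
    using pos by (simp add: powr_mult[symmetric])
  have dquarter: "d powr s / 4 \<le> (d / 2) powr s"
    unfolding d2 using half mult_right_mono[OF half, of "d powr s"] by simp
  have "N \<ge> 0" using \<open>0 \<le> n\<close> \<open>n \<le> N\<close> by simp
  have const: "1 / (20480 * pi) \<le> 1/4" using pi_gt3 by (simp add: field_simps)
  show ?thesis
  proof (cases "r \<le> d")
    case True
    have "1 / (20480 * pi) * n * r powr s \<le> 1/4 * N * d powr s"
      using True pos s const \<open>n \<le> N\<close> by (intro mult_mono powr_mono2) auto
    also have "\<dots> \<le> N * (d / 2) powr s"
      using mult_left_mono[OF dquarter \<open>N \<ge> 0\<close>] by simp
    finally show ?thesis .
  next
    case False
    define W where "W = r powr (2 - s) * d powr (s - 1)"
    have "d = d powr (2 - s) * d powr (s - 1)" using pos by (simp flip: powr_add)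
    also have "\<dots> \<le> W" unfolding W_def using False pos s by (intro mult_right_mono powr_mono2) auto
    finally have dW: "d \<le> W" .
    have "(1/2 :: real) powr 1 \<le> (1/2) powr (s - 1)" using s by (intro powr_mono') auto
    then have "1/2 * h powr (s - 1) \<le> (1/2) powr (s - 1) * h powr (s - 1)"
      by (intro mult_right_mono) auto
    also have "\<dots> = (h / 2) powr (s - 1)" using pos by (simp add: powr_mult[symmetric])
    also have "\<dots> \<le> d powr (s - 1)" using pos s \<open>h \<le> 2 * d\<close> by (intro powr_mono2) auto
    finally have "r powr (2 - s) * (1/2 * h powr (s - 1)) \<le> W"
      unfolding W_def by (intro mult_left_mono) auto
    then have "d + 3 \<le> 2 * W" using key dW by simp
    have rr: "r powr s * r powr (2 - s) = r\<^sup>2" using pos by (simp flip: powr_add)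
    have dd: "d * d powr (s - 1) = d powr s" using pos by (simp add: powr_mult_base)
    have "1 / (20480 * pi) * n * r powr s \<le> 1 / (20480 * pi) * (5 * (d / h) * (2 * W)) * r powr s"
      using n mult_left_mono[OF \<open>d + 3 \<le> 2 * W\<close>, of "5 * (d / h)"] pos
      by (intro mult_right_mono mult_left_mono) auto
    also have "\<dots> = (r powr s * r powr (2 - s)) / (512 * pi * h) * ((d * d powr (s - 1)) / 4)"
      using pos by (simp add: W_def field_simps)
    also have "\<dots> = r\<^sup>2 / (512 * pi * h) * (d powr s / 4)" unfolding rr dd ..
    also have "\<dots> \<le> N * (d / 2) powr s"
      using N dquarter pos \<open>N \<ge> 0\<close> by (intro mult_mono) auto
    finally show ?thesis .
  qed
qed

text \<open>Sets close to the points of a lattice with spacings \<open>2 h\<close> and \<open>2 \<pi>\<close>: the number of those that lie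
  within distance \<open>d\<close> of each other is bounded by the product of the numbers of columns and rows
  that they occupy.\<close>

lemma grid_cluster_card_le:
  fixes D :: "nat \<times> nat \<Rightarrow> complex set"
  assumes "finite A" "0 < h" "h \<le> 2 * d"
    and cells: "\<And>m j x. (m, j) \<in> A \<Longrightarrow> x \<in> D (m, j) \<Longrightarrow>
        t + 2 * h * real m - h / 8 \<le> Re x \<and> Re x \<le> t + 2 * h * real m + 9 * h / 8 \<and>
        2 * pi * real j - 1/8 \<le> Im x \<and> Im x \<le> 2 * pi * real j + 2 * pi + 1/8"
    and close: "\<And>i i'. i \<in> A \<Longrightarrow> i' \<in> A \<Longrightarrow> \<exists>x\<in>D i. \<exists>x'\<in>D i'. norm (x - x') \<le> d"
  shows "real (card A) \<le> 5 * (d / h) * (d + 3)"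
proof -
  have "d > 0" using assms by simp
  have diffs: "real m - real m' \<le> d / (2 * h) + 5/8 \<and> real j - real j' \<le> d + 2"
    if "(m, j) \<in> A" "(m', j') \<in> A" for m j m' j'
  proof -
    obtain x x' where x: "x \<in> D (m, j)" "x' \<in> D (m', j')" "norm (x - x') \<le> d"
      using close \<open>(m, j) \<in> A\<close> \<open>(m', j') \<in> A\<close> by blast
    have "Re x - Re x' \<le> d" "Im x - Im x' \<le> d"
      using x(3) abs_Re_le_cmod[of "x - x'"] abs_Im_le_cmod[of "x - x'"] by auto
    then have "2 * h * real m - 2 * h * real m' \<le> d + 5 * h / 4" "2 * pi * real j - 2 * pi * real j' \<le> d + 2 * pi + 1/4"
      using cells[OF that(1) x(1)] cells[OF that(2) x(2)] by linarith+
    then have re: "2 * h * (real m - real m') \<le> d + 5 * h / 4" and im: "2 * pi * (real j - real j') \<le> d + 2 * pi + 1/4"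
      by (simp_all add: algebra_simps)
    have "real m - real m' \<le> (d + 5 * h / 4) / (2 * h)"
      using re \<open>0 < h\<close> by (simp add: field_simps)
    also have "\<dots> = d / (2 * h) + 5/8" using \<open>0 < h\<close> by (simp add: field_simps)
    finally have m: "real m - real m' \<le> d / (2 * h) + 5/8" .
    have "2 * pi * (real j - real j') \<le> 2 * pi * (d + 2)"
    proof -
      have "2 * pi * d \<ge> 2 * 3 * d" using pi_gt3 \<open>d > 0\<close> by (intro mult_right_mono) auto
      then have "d + 2 * pi + 1/4 \<le> 2 * pi * d + 4 * pi" using pi_gt3 \<open>d > 0\<close> by linarith
      then show ?thesis using im by (simp add: algebra_simps)
    qed
    then have "real j - real j' \<le> d + 2" using pi_gt_zero by simp
    with m show ?thesis ..
  qed
  have "real (card (fst ` A)) \<le> d / (2 * h) + 5/8 + 1"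
  proof (rule card_nat_set_le)
    show "real x - real y \<le> d / (2 * h) + 5/8" if "x \<in> fst ` A" "y \<in> fst ` A" for x y
      using that diffs by fastforce
  qed (use assms \<open>d > 0\<close> in auto)
  also have "\<dots> \<le> 5 * (d / h)"
  proof -
    have "1 / 2 \<le> d / h" using assms by (simp add: field_simps)
    moreover have "d / (2 * h) = 1/2 * (d / h)" by simp
    ultimately show ?thesis by linarith
  qed
  finally have 1: "real (card (fst ` A)) \<le> 5 * (d / h)" .
  have "real (card (snd ` A)) \<le> d + 2 + 1"
  proof (rule card_nat_set_le)
    show "real x - real y \<le> d + 2" if "x \<in> snd ` A" "y \<in> snd ` A" for x y
      using that diffs by fastforce
  qed (use assms \<open>d > 0\<close> in auto)
  then have 2: "real (card (snd ` A)) \<le> d + 3" by simp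
  have "card A \<le> card (fst ` A \<times> snd ` A)"
    using \<open>finite A\<close> by (intro card_mono) (auto intro: rev_image_eqI)
  then have "real (card A) \<le> real (card (fst ` A)) * real (card (snd ` A))"
    by (simp add: card_cartesian_product flip: of_nat_mult)
  also have "\<dots> \<le> 5 * (d / h) * (d + 3)"
    using 1 2 \<open>d > 0\<close> \<open>0 < h\<close> by (intro mult_mono) auto
  finally show ?thesis .
qed

section \<open>The tree of pulled-back discs\<close>

text \<open>The data of a tract in its logarithmic coordinate, together with a distortion constant \<open>\<Lambda>\<close>, a
  dimension \<open>s\<close> to be reached and an auxiliary exponent \<open>e\<close>. For \<open>e = 0\<close> the inequality \<open>key\<close> reads
  \<open>q (s - 1) < 1\<close>, that is \<open>s < 1 + 1 / q\<close>.\<close>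

locale log_tract =
  fixes G :: "complex \<Rightarrow> complex" and \<rho> T0 \<Lambda> q e s :: real
  assumes \<rho>_pos: "0 < \<rho>" and holG: "G holomorphic_on {z. Re z > \<rho>}"
    and inj_exp_G: "inj_on (\<lambda>z. exp (G z)) {z. Re z > \<rho>}"
    and \<Lambda>: "2 \<le> \<Lambda>"
    and distortion: "\<And>g a r x. \<lbrakk>0 < r; g holomorphic_on ball a (\<Lambda> * r); inj_on g (ball a (\<Lambda> * r)); x \<in> cball a r\<rbrakk>
       \<Longrightarrow> norm (deriv g x - deriv g a) \<le> norm (deriv g a) / 2"
    and T0: "2 * \<rho> < T0" "1 \<le> T0"
    and growth: "\<And>x::real. x \<ge> T0 \<Longrightarrow> Re (G x) \<ge> 1 \<and> ln x \<le> Re (G x) powr (q + e)"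
    and q: "1 \<le> q" and e: "0 < e" "e < 1" and s: "1 < s" "s < 2"
    and key: "(q - 1 + 3 * e) * (s - 1) < (1 - e) * (2 - s)"
begin

lemma inj_G: "inj_on G {z. Re z > \<rho>}"
  using inj_exp_G by (auto simp: inj_on_def)

lemma ball_half_plane: "ball (complex_of_real \<tau>) r \<subseteq> {z. Re z > \<rho>}" if "\<rho> + r \<le> \<tau>"
proof
  fix z assume "z \<in> ball (complex_of_real \<tau>) r"
  then have "\<bar>Re (of_real \<tau> - z)\<bar> < r" using abs_Re_le_cmod[of "of_real \<tau> - z"] by (simp add: dist_norm)
  then show "z \<in> {z. Re z > \<rho>}" using that by auto
qed

lemma bilipschitz:
  assumes "g holomorphic_on ball a (\<Lambda> * r)" "inj_on g (ball a (\<Lambda> * r))" "0 < r"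
    and xy: "x \<in> cball a r" "y \<in> cball a r"
  shows "norm (g x - g y) \<le> 3/2 * norm (deriv g a) * norm (x - y)"
    and "1/2 * norm (deriv g a) * norm (x - y) \<le> norm (g x - g y)"
proof -
  have "r * 1 < r * \<Lambda>" using \<Lambda> \<open>0 < r\<close> by (intro mult_strict_left_mono) auto
  then have "cball a r \<subseteq> ball a (\<Lambda> * r)" by (auto simp: mult.commute)
  note * = bilipschitz_of_deriv_distortion[OF assms(1) open_ball this distortion[OF assms(3,1,2)] xy]
  show "norm (g x - g y) \<le> 3/2 * norm (deriv g a) * norm (x - y)"
    and "1/2 * norm (deriv g a) * norm (x - y) \<le> norm (g x - g y)"
    using * by blast+
qed

lemma deriv_G_bound: "\<tau> * norm (deriv G (of_real \<tau>)) \<le> 24 * pi" if "T0 \<le> \<tau>"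
proof -
  define r where "r = \<tau> - \<rho>"
  have "0 < r" "\<tau> \<le> 2 * r" using T0 that \<rho>_pos by (auto simp: r_def)
  have sub: "ball (complex_of_real \<tau>) r \<subseteq> {z. Re z > \<rho>}" by (rule ball_half_plane) (simp add: r_def)
  have "r * norm (deriv G (of_real \<tau>)) \<le> 12 * pi"
    using holomorphic_on_subset[OF holG sub] inj_on_subset[OF inj_exp_G sub] \<open>0 < r\<close>
    by (rule log_univalent_deriv_bound)
  moreover have "\<tau> * norm (deriv G (of_real \<tau>)) \<le> 2 * r * norm (deriv G (of_real \<tau>))"
    using \<open>\<tau> \<le> 2 * r\<close> by (intro mult_right_mono) auto
  ultimately show ?thesis by simp
qed

definition "u v = Re (G (of_real (exp v)))"
definition "u' v = exp v * Re (deriv G (of_real (exp v)))"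

lemma has_deriv_u: "(u has_real_derivative u' v) (at v)" if "ln T0 \<le> v"
proof -
  have "T0 \<le> exp v" using that T0 by (metis exp_le_cancel_iff exp_ln less_le_trans zero_less_one)
  then have "Re (of_real (exp v)) > \<rho>" using T0 \<rho>_pos by simp
  then have dG: "(G has_field_derivative deriv G (of_real (exp v))) (at (of_real (exp v)))"
    using open_halfspace_Re_gt by (intro holomorphic_derivI[OF holG]) auto
  have "((\<lambda>v. complex_of_real (exp v)) has_vector_derivative of_real (exp v)) (at v)"
    by (intro has_vector_derivative_of_real) (auto intro!: derivative_eq_intros simp flip: has_real_derivative_iff_has_vector_derivative)
  from field_vector_diff_chain_at[OF this dG]
  have "((\<lambda>v. G (of_real (exp v))) has_vector_derivative of_real (exp v) * deriv G (of_real (exp v))) (at v)"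
    by (simp add: o_def)
  then have "((\<lambda>v. Re (G (of_real (exp v)))) has_vector_derivative Re (of_real (exp v) * deriv G (of_real (exp v)))) (at v)"
    by (rule bounded_linear.has_vector_derivative[OF bounded_linear_Re])
  then show ?thesis
    unfolding u_def[abs_def] u'_def by (simp add: has_real_derivative_iff_has_vector_derivative)
qed

lemma abs_u'_le: "\<bar>u' v\<bar> \<le> exp v * norm (deriv G (of_real (exp v)))"
  unfolding u'_def abs_mult using abs_Re_le_cmod by (simp add: mult_left_mono)

text \<open>The derivative bound shows that \<open>Re G(x)\<close> grows at most logarithmically. Therefore passing from a
  disc to those of the next generation moves the centre exponentially far to the right.\<close>

lemma u_upper: "u v \<le> 24 * pi * v + u (ln T0)" if "ln T0 \<le> v"
proof (cases "v = ln T0")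
  case True
  have "0 \<le> ln T0" using T0 by simp
  then show ?thesis using True by simp
next
  case False
  then have "ln T0 < v" using that by simp
  then obtain z where z: "ln T0 < z" "z < v" "u v - u (ln T0) = (v - ln T0) * u' z"
    using MVT2[of "ln T0" v u u'] has_deriv_u by auto
  have "T0 \<le> exp z" using z(1) T0 by (metis exp_less_cancel_iff exp_ln less_imp_le less_le_trans zero_less_one)
  then have "u' z \<le> 24 * pi"
    using abs_u'_le[of z] deriv_G_bound[of "exp z"] by linarith
  have "0 \<le> ln T0" using T0 by simp
  have "(v - ln T0) * u' z \<le> (v - ln T0) * (24 * pi)"
    using \<open>u' z \<le> 24 * pi\<close> that by (intro mult_left_mono) auto
  also have "\<dots> \<le> v * (24 * pi)" using \<open>0 \<le> ln T0\<close> by (intro mult_right_mono) auto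
  finally have "u v - u (ln T0) \<le> v * (24 * pi)" unfolding z(3) .
  then show ?thesis by (simp add: algebra_simps)
qed

text \<open>The slow crossings in the variable \<open>ln x\<close>. The derivative of \<open>Re G(x)\<close> with respect to \<open>ln x\<close> is at
  most \<open>x \<bar>G'(x)\<bar>\<close>, and the growth condition bounds the time at which the crossing is completed.\<close>

lemma good_positions:
  assumes "u (ln T0) \<le> t" "0 < h" "0 \<le> t" and M: "2 * (t + 2 * h * real M) powr (q + e) \<le> real M"
  obtains S \<tau> where "S \<subseteq> {..<M}" "M \<le> 2 * card S"
    "\<And>m. m \<in> S \<Longrightarrow> T0 \<le> \<tau> m \<and> t + 2 * h * real m \<le> Re (G (of_real (\<tau> m))) \<and>
       Re (G (of_real (\<tau> m))) \<le> t + 2 * h * real m + h \<and> h \<le> \<tau> m * norm (deriv G (of_real (\<tau> m)))"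
proof -
  define Y where "Y = t + 2 * h * real M"
  define A where "A = ln T0"
  have "A \<ge> 0" using T0 by (simp add: A_def)
  have "0 \<le> h * real M" using \<open>0 < h\<close> by simp
  then have Y: "t \<le> Y" "0 \<le> Y" using \<open>0 \<le> t\<close> by (auto simp: Y_def)
  have gr: "1 \<le> u v \<and> v \<le> u v powr (q + e)" if "A \<le> v" for v
  proof -
    have "T0 \<le> exp v" using that T0 unfolding A_def by (metis exp_le_cancel_iff exp_ln less_le_trans zero_less_one)
    then show ?thesis using growth[of "exp v"] by (simp add: u_def)
  qed
  \<comment> \<open>By the growth condition \<open>u\<close> must have passed \<open>Y\<close> by the time \<open>V\<close>.\<close>
  define V where "V = Y powr (q + e) + A + 1"
  have "A \<le> V" by (simp add: V_def)
  have "Y \<le> u V"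
  proof (rule ccontr)
    assume "\<not> Y \<le> u V"
    then have "u V powr (q + e) \<le> Y powr (q + e)"
      using gr[OF \<open>A \<le> V\<close>] q e by (intro powr_mono2) auto
    then show False using gr[OF \<open>A \<le> V\<close>] \<open>A \<ge> 0\<close> by (simp add: V_def)
  qed
  have "continuous_on {A..V} u"
    unfolding A_def
    by (intro continuous_at_imp_continuous_on ballI DERIV_isCont[OF has_deriv_u]) simp
  then obtain B where B: "A \<le> B" "B \<le> V" "u B = Y"
    using IVT'[of u A Y V] assms(1) Y \<open>Y \<le> u V\<close> \<open>A \<le> V\<close> unfolding A_def by auto
  have "B \<le> Y powr (q + e)" using gr[OF B(1)] B(3) by simp
  then have short: "2 * (B - A) \<le> real M" using M \<open>A \<ge> 0\<close> by (simp add: Y_def)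
  obtain S where S: "S \<subseteq> {..<M}" "M \<le> 2 * card S"
    "\<And>m. m \<in> S \<Longrightarrow> \<exists>v\<in>{A..B}. t + 2 * h * real m \<le> u v \<and> u v \<le> t + 2 * h * real m + h \<and> h \<le> u' v"
    using many_slow_crossings[of A B u u' t h M] has_deriv_u B assms(1,2) short
    unfolding A_def Y_def by (metis atLeastAtMost_iff order_refl)
  have "\<exists>x. T0 \<le> x \<and> t + 2 * h * real m \<le> Re (G (of_real x)) \<and>
       Re (G (of_real x)) \<le> t + 2 * h * real m + h \<and> h \<le> x * norm (deriv G (of_real x))" if m: "m \<in> S" for m
  proof -
    obtain v where v: "A \<le> v" "t + 2 * h * real m \<le> u v" "u v \<le> t + 2 * h * real m + h" "h \<le> u' v"
      using S(3)[OF m] by auto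
    have "T0 \<le> exp v" using v(1) T0 unfolding A_def by (metis exp_le_cancel_iff exp_ln less_le_trans zero_less_one)
    then show ?thesis using v abs_u'_le[of v] by (intro exI[of _ "exp v"]) (auto simp: u_def)
  qed
  then obtain \<tau> where "\<And>m. m \<in> S \<Longrightarrow> T0 \<le> \<tau> m \<and> t + 2 * h * real m \<le> Re (G (of_real (\<tau> m))) \<and>
       Re (G (of_real (\<tau> m))) \<le> t + 2 * h * real m + h \<and> h \<le> \<tau> m * norm (deriv G (of_real (\<tau> m)))"
    by metis
  with S(1,2) show ?thesis by (rule that)
qed

text \<open>The factor is chosen such that a disc of radius \<open>a h / \<bar>G'(\<tau>)\<bar>\<close>, even when enlarged \<open>\<Lambda>\<close> times, has an image
  within distance \<open>h/8\<close> of \<open>G(\<tau>)\<close>, while the disc that is \<open>\<Lambda>\<^sup>2\<close> times as large still lies in the half-plane, so that the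
  distortion bound applies.\<close>

definition "a = 1 / (12 * \<Lambda>\<^sup>2)"

definition "shift k w = w + of_int (2 * k) * of_real pi * \<i>" for k :: int

lemma a_bounds: "0 < a" "a \<le> 1/12"
proof -
  have "1 \<le> \<Lambda>\<^sup>2" using \<Lambda> by (simp add: one_le_power)
  moreover from this have "0 < \<Lambda>\<^sup>2" by linarith
  ultimately show "0 < a" "a \<le> 1/12" by (simp_all add: a_def divide_le_eq_1)
qed

lemma pulled_back_ball:
  assumes \<tau>: "T0 \<le> \<tau>" and h: "0 < h" "h \<le> \<tau> * norm (deriv G (of_real \<tau>))"
  defines "r \<equiv> a * h / norm (deriv G (of_real \<tau>))"
  shows "0 < r" "r \<le> \<tau> / 2" "ball (of_real \<tau>) (\<Lambda> * r) \<subseteq> {z. Re z > \<rho>}"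
    "\<And>z. z \<in> cball (of_real \<tau>) (\<Lambda> * r) \<Longrightarrow> norm (G z - G (of_real \<tau>)) \<le> h / 8"
    "norm (deriv G (of_real \<tau>)) * r = a * h"
proof -
  define d where "d = norm (deriv G (of_real \<tau>))"
  have "d > 0" using h unfolding d_def by (cases "deriv G (of_real \<tau>) = 0") auto
  have "\<tau> > 0" using \<tau> T0 by simp
  show "0 < r" using a_bounds h \<open>d > 0\<close> by (simp add: r_def d_def)
  have "h / d \<le> \<tau>" using h(2) \<open>d > 0\<close> by (simp add: d_def field_simps)
  then have r\<tau>: "r \<le> a * \<tau>"
    unfolding r_def d_def[symmetric] using mult_left_mono[of "h / d" \<tau> a] a_bounds by simp
  have "a * \<tau> \<le> 1/2 * \<tau>" using a_bounds \<open>\<tau> > 0\<close> by (intro mult_right_mono) auto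
  then show "r \<le> \<tau> / 2" using r\<tau> by simp
  have "\<Lambda>\<^sup>2 * a = 1/12" using \<Lambda> by (simp add: a_def)
  have "\<Lambda> * (\<Lambda> * r) \<le> \<Lambda>\<^sup>2 * (a * \<tau>)"
    using r\<tau> by (simp add: power2_eq_square mult.assoc mult_left_mono \<Lambda> order_trans[OF _ \<Lambda>])
  also have "\<dots> = \<tau> / 12" using \<open>\<Lambda>\<^sup>2 * a = 1/12\<close> by (simp flip: mult.assoc)
  finally have r2: "\<Lambda> * (\<Lambda> * r) \<le> \<tau> / 12" .
  have big: "ball (complex_of_real \<tau>) (\<Lambda> * (\<Lambda> * r)) \<subseteq> {z. Re z > \<rho>}"
    by (rule ball_half_plane) (use r2 \<tau> T0 \<rho>_pos in linarith)
  have "1 * (\<Lambda> * r) \<le> \<Lambda> * (\<Lambda> * r)" using \<Lambda> \<open>0 < r\<close> by (intro mult_right_mono) auto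
  then show "ball (of_real \<tau>) (\<Lambda> * r) \<subseteq> {z. Re z > \<rho>}"
    using big subset_ball by (metis mult_1 order_trans)
  show dr: "norm (deriv G (of_real \<tau>)) * r = a * h" using \<open>d > 0\<close> by (simp add: r_def d_def)
  have "\<Lambda> * r > 0" using \<Lambda> \<open>0 < r\<close> by simp
  show "norm (G z - G (of_real \<tau>)) \<le> h / 8" if z: "z \<in> cball (of_real \<tau>) (\<Lambda> * r)" for z
  proof -
    have "norm (G z - G (of_real \<tau>)) \<le> 3/2 * d * norm (z - of_real \<tau>)"
      unfolding d_def
      by (rule bilipschitz[OF holomorphic_on_subset[OF holG big] inj_on_subset[OF inj_G big] \<open>\<Lambda> * r > 0\<close> z])
        (use \<open>\<Lambda> * r > 0\<close> in auto)
    also have "\<dots> \<le> 3/2 * d * (\<Lambda> * r)"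
      using z \<open>d > 0\<close> by (intro mult_left_mono) (auto simp: dist_norm norm_minus_commute)
    also have "\<dots> = 3/2 * \<Lambda> * (a * h)" using dr by (simp add: d_def mult_ac)
    also have "\<dots> = h / (8 * \<Lambda>)" using \<Lambda> by (simp add: a_def power2_eq_square field_simps)
    also have "\<dots> \<le> h / 8" using \<Lambda> h by (simp add: field_simps)
    finally show ?thesis .
  qed
qed

definition "\<kappa> = q - 1 + 3 * e"

text \<open>The spacing of the cells at level \<open>t\<close> is slightly below \<open>t\<^bsup>1-q\<^esup>\<close>.\<close>

definition "\<eta> t = t powr - \<kappa>"

text \<open>The conditions on \<open>t\<close> under which a disc about \<open>t\<close> has enough children. The two lower bounds for
  \<open>t\<^bsup>(1-e)(2-s)-\<kappa>(s-1)\<^esup>\<close> give the spread and the number of children, the next condition bounds the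
  duration of the crossing, and the last one ensures that the children are again valid nodes.\<close>

definition "large t \<longleftrightarrow> T0 \<le> t \<and> u (ln T0) \<le> t \<and> 100 \<le> t powr (1 - e) \<and>
   6 \<le> t powr ((1 - e) * (2 - s) - \<kappa> * (s - 1)) \<and>
   2048 * pi / a\<^sup>2 \<le> t powr ((1 - e) * (2 - s) - \<kappa> * (s - 1)) \<and>
   2 * (2 * t) powr (q + e) \<le> t powr (q + 2 * e) / 16 \<and>
   (\<forall>\<tau>\<ge>T0. t \<le> Re (G (of_real \<tau>)) \<longrightarrow> 2 * t \<le> \<tau> \<and> 24 * pi \<le> a * \<eta> t * \<tau> powr e)"

lemma \<kappa>_pos: "\<kappa> > 0" using q e by (simp add: \<kappa>_def)

lemma eventually_large: "\<forall>\<^sub>F t in at_top. large t"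
proof -
  have pw: "\<forall>\<^sub>F t in at_top. c \<le> t powr p" if "p > 0" for c p :: real
  proof -
    have "filterlim (\<lambda>t::real. t powr p) at_top at_top" using that by real_asymp
    then show ?thesis by (simp add: filterlim_at_top)
  qed
  define p where "p = (1 - e) * (2 - s) - \<kappa> * (s - 1)"
  have "p > 0" using key by (simp add: p_def \<kappa>_def)
  have 1: "\<forall>\<^sub>F t in at_top. 2 * (2 * t) powr (q + e) \<le> t powr (q + 2 * e) / 16"
    using pw[OF e(1), of "32 * 2 powr (q + e)"] eventually_gt_at_top[of 0]
  proof eventually_elim
    case (elim t)
    have "2 * (2 * t) powr (q + e) = (32 * 2 powr (q + e)) * t powr (q + e) / 16"
      using elim by (simp add: powr_mult)
    also have "\<dots> \<le> t powr e * t powr (q + e) / 16"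
      using elim e by (intro divide_right_mono mult_right_mono) auto
    also have "t powr e * t powr (q + e) = t powr (q + 2 * e)"
      by (simp add: add_ac flip: powr_add)
    finally show ?case .
  qed
  define c1 where "c1 = 24 * pi"
  define c2 where "c2 = u (ln T0)"
  have "c1 > 0" by (simp add: c1_def)
  \<comment> \<open>\<open>Re G\<close> reaches \<open>t\<close> only at points that are exponentially large in \<open>t\<close>.\<close>
  have lower: "exp ((t - c2) / c1) \<le> \<tau>" if \<tau>: "T0 \<le> \<tau>" "t \<le> Re (G (of_real \<tau>))" for \<tau> t
  proof -
    have "\<tau> > 0" using \<tau> T0 by simp
    then have "ln T0 \<le> ln \<tau>" using \<tau> T0 by simp
    then have "u (ln \<tau>) \<le> c1 * ln \<tau> + c2" using u_upper by (simp add: c1_def c2_def)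
    moreover have "u (ln \<tau>) = Re (G (of_real \<tau>))" using \<open>\<tau> > 0\<close> by (simp add: u_def)
    ultimately have "(t - c2) / c1 \<le> ln \<tau>" using \<tau> \<open>c1 > 0\<close> by (simp add: field_simps)
    then show ?thesis using \<open>\<tau> > 0\<close> by (metis exp_le_cancel_iff exp_ln)
  qed
  have 2: "\<forall>\<^sub>F t in at_top. 2 * t \<le> exp ((t - c2) / c1)"
    using \<open>c1 > 0\<close> by real_asymp
  have 3: "\<forall>\<^sub>F t in at_top. 24 * pi \<le> a * t powr - \<kappa> * exp (e * ((t - c2) / c1))"
    using \<open>c1 > 0\<close> e a_bounds \<kappa>_pos by real_asymp
  have 4: "\<forall>\<^sub>F t in at_top. \<forall>\<tau>\<ge>T0. t \<le> Re (G (of_real \<tau>)) \<longrightarrow> 2 * t \<le> \<tau> \<and> 24 * pi \<le> a * \<eta> t * \<tau> powr e"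
    using 2 3
  proof eventually_elim
    case (elim t)
    show ?case
    proof (intro allI impI conjI)
      fix \<tau> assume \<tau>: "\<tau> \<ge> T0" "t \<le> Re (G (of_real \<tau>))"
      show "2 * t \<le> \<tau>" using elim(1) lower[OF \<tau>] by linarith
      have "exp (e * ((t - c2) / c1)) = exp ((t - c2) / c1) powr e"
        by (simp add: powr_def)
      also have "\<dots> \<le> \<tau> powr e" using lower[OF \<tau>] e by (intro powr_mono2) auto
      finally have "a * \<eta> t * exp (e * ((t - c2) / c1)) \<le> a * \<eta> t * \<tau> powr e"
        using a_bounds by (intro mult_left_mono) (auto simp: \<eta>_def)
      then show "24 * pi \<le> a * \<eta> t * \<tau> powr e" using elim(2) by (simp add: \<eta>_def)
    qed
  qed
  have "1 - e > 0" using e by simp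
  show ?thesis
    using eventually_ge_at_top[of T0] eventually_ge_at_top[of "u (ln T0)"]
      pw[OF \<open>1 - e > 0\<close>, of 100] pw[OF \<open>p > 0\<close>, of 6] pw[OF \<open>p > 0\<close>, of "2048 * pi / a\<^sup>2"] 1 4
    by eventually_elim (simp add: large_def p_def)
qed

text \<open>A node \<open>(g, t, r)\<close> consists of a disc about \<open>t\<close> with radius \<open>r\<close> in the half-plane and of the
  composition \<open>g\<close> of the inverse branches that carries this disc back to the dynamical plane. Its weight \<open>wt\<close> is comparable to the diameter of its piece.\<close>

definition piece :: "(complex \<Rightarrow> complex) \<times> real \<times> real \<Rightarrow> complex set" where
  "piece v = (case v of (g, t, r) \<Rightarrow> g ` cball (of_real t) r)"

definition wt :: "(complex \<Rightarrow> complex) \<times> real \<times> real \<Rightarrow> real" where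
  "wt v = (case v of (g, t, r) \<Rightarrow> norm (deriv g (of_real t)) * r)"

text \<open>Univalence is required on the disc enlarged \<open>\<Lambda>\<close> times, where it guarantees bounded distortion on
  the disc itself.\<close>

definition node :: "real \<Rightarrow> (complex \<Rightarrow> complex) \<times> real \<times> real \<Rightarrow> bool" where
  "node T v \<longleftrightarrow> (case v of (g, t, r) \<Rightarrow> T \<le> t \<and> t powr (1 - e) \<le> r \<and> r \<le> t / 2 \<and>
     g holomorphic_on ball (of_real t) (\<Lambda> * r) \<and> inj_on g (ball (of_real t) (\<Lambda> * r)))"

definition child :: "(complex \<Rightarrow> complex) \<times> real \<times> real \<Rightarrow> (complex \<Rightarrow> complex) \<times> real \<times> real \<Rightarrow> bool" where
  "child v v' \<longleftrightarrow> (case (v, v') of ((g, t, r), (g', t', r')) \<Rightarrow> 2 * t \<le> t' \<and> 2 * wt v' \<le> wt v \<and>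
     (\<exists>k. g' = (\<lambda>z. g (shift k (G z))) \<and> (\<forall>z\<in>cball (of_real t') r'. shift k (G z) \<in> cball (of_real t) r)))"

lemma Re_shift [simp]: "Re (shift k w) = Re w"
  and Im_shift: "Im (shift k w) = Im w + 2 * pi * of_int k"
  by (simp_all add: shift_def)

lemma exp_shift [simp]: "exp (shift k w) = exp w"
  unfolding shift_def exp_eq by (intro exI[of _ k]) simp

lemma pulled_back_map:
  assumes g: "g holomorphic_on ball p r" "inj_on g (ball p r)"
    and sub: "ball b r' \<subseteq> {z. Re z > \<rho>}" "\<And>z. z \<in> ball b r' \<Longrightarrow> shift k (G z) \<in> ball p r" and "0 < r'"
  shows "(\<lambda>z. g (shift k (G z))) holomorphic_on ball b r'"
    and "inj_on (\<lambda>z. g (shift k (G z))) (ball b r')"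
    and "deriv (\<lambda>z. g (shift k (G z))) b = deriv g (shift k (G b)) * deriv G b"
proof -
  have G: "(\<lambda>z. shift k (G z)) holomorphic_on ball b r'"
    unfolding shift_def by (intro holomorphic_intros holomorphic_on_subset[OF holG sub(1)])
  have "(\<lambda>z. shift k (G z)) ` ball b r' \<subseteq> ball p r" using sub(2) by auto
  from holomorphic_on_compose_gen[OF G g(1) this]
  show "(\<lambda>z. g (shift k (G z))) holomorphic_on ball b r'" by (simp add: o_def)
  show "inj_on (\<lambda>z. g (shift k (G z))) (ball b r')"
  proof (rule inj_onI)
    fix y z assume yz: "y \<in> ball b r'" "z \<in> ball b r'" "g (shift k (G y)) = g (shift k (G z))"
    then have "shift k (G y) = shift k (G z)" using inj_onD[OF g(2)] sub(2) by blast
    then have "G y = G z" by (simp add: shift_def)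
    then show "y = z" using inj_onD[OF inj_G] sub(1) yz by blast
  qed
  have b: "b \<in> ball b r'" using \<open>0 < r'\<close> by simp
  have "(G has_field_derivative deriv G b) (at b)"
    using sub(1) b by (intro holomorphic_derivI[OF holomorphic_on_subset[OF holG sub(1)]]) auto
  then have "((\<lambda>z. shift k (G z)) has_field_derivative deriv G b) (at b)"
    unfolding shift_def by (auto intro!: derivative_eq_intros)
  moreover have "(g has_field_derivative deriv g (shift k (G b))) (at (shift k (G b)))"
    using sub(2)[OF b] by (intro holomorphic_derivI[OF g(1)]) auto
  ultimately have "((\<lambda>z. g (shift k (G z))) has_field_derivative deriv g (shift k (G b)) * deriv G b) (at b)"
    by (rule DERIV_chain2[rotated])
  then show "deriv (\<lambda>z. g (shift k (G z))) b = deriv g (shift k (G b)) * deriv G b"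
    by (rule DERIV_imp_deriv)
qed

lemma cball_subset_ball_\<Lambda>: "cball x r \<subseteq> ball x (\<Lambda> * r)" if "0 < r"
proof -
  have "r * 1 < r * \<Lambda>" using \<Lambda> that by (intro mult_strict_left_mono) auto
  then show ?thesis by (auto simp: mult.commute)
qed

lemma piece_le_wt:
  assumes "node T (g, t, r)" "0 < r" "x \<in> piece (g, t, r)" "y \<in> piece (g, t, r)"
  shows "norm (x - y) \<le> 3 * wt (g, t, r)"
proof -
  obtain x' y' where xy: "x' \<in> cball (of_real t) r" "y' \<in> cball (of_real t) r" "x = g x'" "y = g y'"
    using assms by (auto simp: piece_def)
  have "norm (x' - y') \<le> 2 * r"
    using xy(1,2) norm_triangle_ineq4[of "x' - of_real t" "y' - of_real t"] by (simp add: dist_norm norm_minus_commute)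
  then have le: "3/2 * norm (deriv g (of_real t)) * norm (x' - y') \<le> 3/2 * norm (deriv g (of_real t)) * (2 * r)"
    by (intro mult_left_mono) auto
  have "norm (x - y) \<le> 3/2 * norm (deriv g (of_real t)) * norm (x' - y')"
    unfolding xy(3,4) using assms(1,2) xy(1,2) by (intro bilipschitz(1)) (auto simp: node_def)
  also note le
  finally show ?thesis by (simp add: wt_def mult_ac)
qed

lemma node_r_pos: "0 < r" if "node T (g, t, r)" "0 < T"
proof -
  have "0 < t" "t powr (1 - e) \<le> r" using that by (auto simp: node_def)
  then have "0 < t powr (1 - e)" by simp
  then show ?thesis using \<open>t powr (1 - e) \<le> r\<close> by linarith
qed

lemma wt_le_diameter:
  assumes v: "node T (g, t, r)" "0 < T" and V: "bounded V" "piece (g, t, r) \<subseteq> V"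
  shows "wt (g, t, r) \<le> diameter V"
proof -
  have "0 < r" using node_r_pos[OF v] .
  let ?x = "complex_of_real t + of_real r" and ?y = "complex_of_real t - of_real r"
  have xy: "?x \<in> cball (of_real t) r" "?y \<in> cball (of_real t) r"
    using \<open>0 < r\<close> by (auto simp: dist_norm)
  have "?x - ?y = of_real (2 * r)" by simp
  then have "norm (?x - ?y) = 2 * r" using \<open>0 < r\<close> by (metis abs_of_pos mult_pos_pos norm_of_real zero_less_numeral)
  then have "wt (g, t, r) = 1/2 * norm (deriv g (of_real t)) * norm (?x - ?y)"
    by (simp add: wt_def)
  also have "\<dots> \<le> norm (g ?x - g ?y)"
    using v(1) xy \<open>0 < r\<close> by (intro bilipschitz(2)) (auto simp: node_def)
  also have "\<dots> \<le> diameter V"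
  proof -
    have "g ?x \<in> V" "g ?y \<in> V" using V(2) xy by (auto simp: piece_def)
    from diameter_bounded_bound[OF V(1) this] show ?thesis by (simp only: dist_norm)
  qed
  finally show ?thesis .
qed

text \<open>The pieces along a branch are nested and at least halve their size at each step. The preimages
  of their common point in the discs of the branch form a backward orbit, and since the centres
  at least double, it tends to infinity.\<close>

lemma limit_point:
  assumes "0 < T" "2 * \<rho> < T"
    and \<sigma>0: "\<sigma> 0 = (g0, t0, r0)"
    and node: "\<And>n. node T (\<sigma> n)" and child: "\<And>n. child (\<sigma> n) (\<sigma> (Suc n))"
  obtains \<zeta> where "\<And>n. Re (\<zeta> n) > \<rho>" "\<And>n. exp (\<zeta> n) = exp (G (\<zeta> (Suc n)))"
    "filterlim (\<lambda>n. Re (\<zeta> n)) at_top sequentially"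
    "\<And>V. open V \<Longrightarrow> g0 (\<zeta> 0) \<in> V \<Longrightarrow> \<exists>n. piece (\<sigma> n) \<subseteq> V"
proof -
  define g t r where "g n = fst (\<sigma> n)" and "t n = fst (snd (\<sigma> n))" and "r n = snd (snd (\<sigma> n))" for n
  have \<sigma>: "\<sigma> n = (g n, t n, r n)" for n by (simp add: g_def t_def r_def)
  note node' = node[unfolded \<sigma>] and child' = child[unfolded \<sigma>]
  have rpos: "0 < r n" for n using node_r_pos[OF node' \<open>0 < T\<close>] .
  have tT: "T \<le> t n" and rt: "r n \<le> t n / 2" and inj: "inj_on (g n) (ball (of_real (t n)) (\<Lambda> * r n))"
    and hol: "g n holomorphic_on ball (of_real (t n)) (\<Lambda> * r n)" for n
    using node'[of n] by (auto simp: node_def)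
  have doubling: "2 * t n \<le> t (Suc n)" and halving: "2 * wt (\<sigma> (Suc n)) \<le> wt (\<sigma> n)" for n
    using child'[of n] by (auto simp: child_def \<sigma>)
  define links where "links n k \<longleftrightarrow> g (Suc n) = (\<lambda>z. g n (shift k (G z))) \<and>
      (\<forall>z\<in>cball (of_real (t (Suc n))) (r (Suc n)). shift k (G z) \<in> cball (of_real (t n)) (r n))" for n k
  have "\<exists>k. links n k" for n
    using child'[of n] by (auto simp: child_def links_def)
  then obtain k where "\<And>n. links n (k n)" by metis
  then have gk: "\<And>n. g (Suc n) = (\<lambda>z. g n (shift (k n) (G z)))"
    and k: "\<And>n z. z \<in> cball (of_real (t (Suc n))) (r (Suc n)) \<Longrightarrow> shift (k n) (G z) \<in> cball (of_real (t n)) (r n)"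
    by (simp_all add: links_def)
  have sub: "cball (of_real (t n)) (r n) \<subseteq> ball (complex_of_real (t n)) (\<Lambda> * r n)" for n
    by (rule cball_subset_ball_\<Lambda>[OF rpos])
  have "piece (\<sigma> (Suc n)) \<subseteq> piece (\<sigma> n)" for n
    using k[of _ n] by (auto simp: \<sigma> piece_def gk)
  then have dec: "piece (\<sigma> n) \<subseteq> piece (\<sigma> m)" if "m \<le> n" for m n
    using lift_Suc_antimono_le[of "\<lambda>n. piece (\<sigma> n)" m n] that by blast
  have ne: "piece (\<sigma> n) \<noteq> {}" for n
    using rpos[of n] by (simp add: \<sigma> piece_def)
  have cpt: "compact (piece (\<sigma> n))" for n
    unfolding \<sigma> piece_def prod.case
    by (intro compact_continuous_image compact_cball
        continuous_on_subset[OF holomorphic_on_imp_continuous_on[OF hol[of n]] sub])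
  from compact_nest[of "\<lambda>n. piece (\<sigma> n)", OF cpt ne dec]
  obtain x where x: "\<And>n. x \<in> piece (\<sigma> n)" by auto
  have "\<exists>z. z \<in> cball (of_real (t n)) (r n) \<and> g n z = x" for n
    using x[of n] unfolding \<sigma> piece_def prod.case by blast
  then obtain \<zeta> where \<zeta>: "\<And>n. \<zeta> n \<in> cball (of_real (t n)) (r n)" "\<And>n. g n (\<zeta> n) = x"
    by metis
  have step: "\<zeta> n = shift (k n) (G (\<zeta> (Suc n)))" for n
  proof (rule inj_onD[OF inj[of n]])
    show "g n (\<zeta> n) = g n (shift (k n) (G (\<zeta> (Suc n))))" using \<zeta>(2)[of n] \<zeta>(2)[of "Suc n"] by (simp add: gk)
  qed (use \<zeta>(1) k sub in blast)+
  have Re_ge: "t n / 2 \<le> Re (\<zeta> n)" for n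
    using abs_Re_le_cmod[of "of_real (t n) - \<zeta> n"] \<zeta>(1)[of n] rt[of n] by (simp add: dist_norm)
  have grow: "2 ^ n * T \<le> t n" for n
  proof (induction n)
    case (Suc n)
    then show ?case using doubling[of n] by simp
  qed (use tT[of 0] in simp)
  show ?thesis
  proof (rule that[of \<zeta>])
    show "Re (\<zeta> n) > \<rho>" for n using Re_ge[of n] tT[of n] assms(2) by linarith
    show "exp (\<zeta> n) = exp (G (\<zeta> (Suc n)))" for n by (subst step) simp
    have lim: "filterlim (\<lambda>n. 2 ^ n * (T / 2)) at_top sequentially"
      using \<open>0 < T\<close> by real_asymp
    have "2 ^ n * (T / 2) \<le> Re (\<zeta> n)" for n using Re_ge[of n] grow[of n] by simp
    then show "filterlim (\<lambda>n. Re (\<zeta> n)) at_top sequentially"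
      by (intro filterlim_at_top_mono[OF lim] always_eventually allI)
    fix V assume V: "open V" "g0 (\<zeta> 0) \<in> V"
    have "g 0 = g0" by (simp add: g_def \<sigma>0)
    then have "x \<in> V" using V(2) \<zeta>(2)[of 0] by simp
    then obtain \<epsilon> where \<epsilon>: "\<epsilon> > 0" "ball x \<epsilon> \<subseteq> V"
      using V(1) unfolding open_contains_ball by blast
    have wn: "wt (\<sigma> n) \<le> wt (\<sigma> 0) * (1/2) ^ n" for n
    proof (induction n)
      case (Suc n)
      then show ?case using halving[of n] by simp
    qed simp
    have "(\<lambda>n. 3 * (wt (\<sigma> 0) * (1/2) ^ n)) \<longlonglongrightarrow> 0" by real_asymp
    then have "\<forall>\<^sub>F n in sequentially. 3 * (wt (\<sigma> 0) * (1/2) ^ n) < \<epsilon>"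
      using \<epsilon>(1) by (rule order_tendstoD)
    then obtain n where n: "3 * (wt (\<sigma> 0) * (1/2) ^ n) < \<epsilon>"
      by (meson eventually_sequentially order_refl)
    have "dist x y < \<epsilon>" if "y \<in> piece (\<sigma> n)" for y
      using piece_le_wt[OF node' rpos, folded \<sigma>, OF x that] wn[of n] n by (simp add: dist_norm)
    then have "piece (\<sigma> n) \<subseteq> ball x \<epsilon>" by auto
    then show "\<exists>n. piece (\<sigma> n) \<subseteq> V" using \<epsilon>(2) by blast
  qed
qed

text \<open>The heart of the construction. The children of \<open>(g, t, r)\<close> are indexed by a good cell \<open>m\<close>
  and a row \<open>j\<close>: the disc of the child is centred at the real number \<open>\<tau> m\<close> and is carried into the
  disc about \<open>t\<close> by \<open>G + 2 \<pi> i k\<close>, where \<open>k\<close> puts the image into the \<open>j\<close>-th strip of height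
  \<open>2 \<pi>\<close>. All images have size about \<open>a h\<close> and lie near the points of a lattice with spacings \<open>2 h\<close> and
  \<open>2 \<pi>\<close>, whence their number is of order \<open>r\<^sup>2 / h\<close>.\<close>

lemma branching:
  assumes v: "node T (g, t, r)" and "0 < T" and large: "\<And>t. T \<le> t \<Longrightarrow> large t"
  shows "\<exists>C. balanced_branching s (1 / (20480 * pi)) piece wt (g, t, r) C \<and>
    (\<forall>w\<in>C. node T w \<and> child (g, t, r) w)"
proof -
  have tT: "T \<le> t" and r: "t powr (1 - e) \<le> r" "r \<le> t / 2"
    and holg: "g holomorphic_on ball (of_real t) (\<Lambda> * r)" and injg: "inj_on g (ball (of_real t) (\<Lambda> * r))"
    using v by (auto simp: node_def)
  have "large t" using large tT by simp
  then have t: "T0 \<le> t" "u (ln T0) \<le> t" "100 \<le> t powr (1 - e)"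
    and key6: "6 \<le> t powr ((1 - e) * (2 - s) - \<kappa> * (s - 1))"
    and keya: "2048 * pi / a\<^sup>2 \<le> t powr ((1 - e) * (2 - s) - \<kappa> * (s - 1))"
    and room: "2 * (2 * t) powr (q + e) \<le> t powr (q + 2 * e) / 16"
    and far: "\<And>\<tau>. \<tau> \<ge> T0 \<Longrightarrow> t \<le> Re (G (of_real \<tau>)) \<Longrightarrow> 2 * t \<le> \<tau> \<and> 24 * pi \<le> a * \<eta> t * \<tau> powr e"
    unfolding large_def by simp_all
  have t1: "1 \<le> t" using t T0 by linarith
  have r100: "100 \<le> r" using t r by linarith
  define h where "h = \<eta> t"
  have h: "0 < h" "h \<le> 1"
    using t1 \<kappa>_pos by (auto simp: h_def \<eta>_def powr_minus field_simps ge_one_powr_ge_zero)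
  define d where "d = norm (deriv g (of_real t))"
  have r0: "0 < r" using r100 by simp
  have \<Lambda>r: "0 < \<Lambda> * r" using r0 \<Lambda> by simp
  have d0: "0 < d"
    using holomorphic_injective_imp_regular[OF holg open_ball injg, of "of_real t"] \<Lambda>r by (simp add: d_def)
  define W where "W = r powr (2 - s) * h powr (s - 1)"
  have tW: "t powr ((1 - e) * (2 - s) - \<kappa> * (s - 1)) \<le> W"
  proof -
    have "t powr ((1 - e) * (2 - s) - \<kappa> * (s - 1)) = (t powr (1 - e)) powr (2 - s) * h powr (s - 1)"
      by (simp add: h_def \<eta>_def powr_powr flip: powr_add)
    also have "\<dots> \<le> W" unfolding W_def using r s by (intro mult_right_mono powr_mono2) auto
    finally show ?thesis .
  qed
  define M where "M = nat \<lfloor>r / (8 * h)\<rfloor>"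
  define J where "J = nat \<lfloor>r / (8 * pi)\<rfloor>"
  have fl: "y / 2 \<le> real (nat \<lfloor>y\<rfloor>)" "real (nat \<lfloor>y\<rfloor>) \<le> y" if "2 \<le> y" for y :: real
    using that by linarith+
  have "2 \<le> r / (8 * h)" using h r100 by (simp add: field_simps)
  then have M: "r / (16 * h) \<le> real M" "real M \<le> r / (8 * h)"
    using fl[of "r / (8 * h)"] unfolding M_def by simp_all
  have "2 \<le> r / (8 * pi)" using pi_less_4 r100 by (simp add: field_simps)
  then have J: "r / (16 * pi) \<le> real J" "real J \<le> r / (8 * pi)"
    using fl[of "r / (8 * pi)"] unfolding J_def by simp_all
  have hM: "8 * h * real M \<le> r" using M(2) h by (simp add: field_simps)
  have hJ: "8 * pi * real J \<le> r" using J(2) by (simp add: field_simps)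
  \<comment> \<open>There are at least twice as many cells as the time available for crossing them.\<close>
  have many: "2 * (t + 2 * h * real M) powr (q + e) \<le> real M"
  proof -
    have "0 \<le> h * real M" using h by simp
    then have "0 \<le> t + 2 * h * real M" "t + 2 * h * real M \<le> 2 * t" using hM r t1 by linarith+
    then have "2 * (t + 2 * h * real M) powr (q + e) \<le> 2 * (2 * t) powr (q + e)"
      using q e by (intro mult_left_mono powr_mono2) auto
    also have "\<dots> \<le> t powr (q + 2 * e) / 16" by (rule room)
    also have "t powr (q + 2 * e) = t powr (1 - e) * t powr \<kappa>"
      by (simp add: \<kappa>_def add.commute flip: powr_add)
    also have "\<dots> / 16 \<le> r * t powr \<kappa> / 16" using r by (intro divide_right_mono mult_right_mono) auto
    also have "\<dots> = r / (16 * h)" by (simp add: h_def \<eta>_def powr_minus field_simps)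
    also have "\<dots> \<le> real M" by (rule M(1))
    finally show ?thesis .
  qed
  have "0 \<le> t" using t1 by simp
  obtain S \<tau> where S: "S \<subseteq> {..<M}" "M \<le> 2 * card S"
    and pos: "\<And>m. m \<in> S \<Longrightarrow> T0 \<le> \<tau> m \<and> t + 2 * h * real m \<le> Re (G (of_real (\<tau> m))) \<and>
       Re (G (of_real (\<tau> m))) \<le> t + 2 * h * real m + h \<and> h \<le> \<tau> m * norm (deriv G (of_real (\<tau> m)))"
    using good_positions[OF t(2) h(1) \<open>0 \<le> t\<close> many] by metis
  define I where "I = S \<times> {..<J}"
  have finI: "finite I" using S finite_subset by (auto simp: I_def)
  \<comment> \<open>The ceiling moves the image of the centre into the strip between heights 0 and \<open>2 \<pi>\<close>, and
    \<open>snd i\<close> then moves it to its row.\<close>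
  define k where "k i = \<lceil>- Im (G (of_real (\<tau> (fst i)))) / (2 * pi)\<rceil> + int (snd i)" for i :: "nat \<times> nat"
  define x where "x i = \<tau> (fst i)" for i :: "nat \<times> nat"
  define r' where "r' i = a * h / norm (deriv G (of_real (x i)))" for i
  define g' where "g' i = (\<lambda>z. g (shift (k i) (G z)))" for i
  define w where "w i = (g' i, x i, r' i)" for i
  define D where "D i = (\<lambda>z. shift (k i) (G z)) ` cball (of_real (x i)) (r' i)" for i
  have x: "T0 \<le> x i" "h \<le> x i * norm (deriv G (of_real (x i)))"
    "t + 2 * h * real (fst i) \<le> Re (G (of_real (x i)))" "Re (G (of_real (x i))) \<le> t + 2 * h * real (fst i) + h"
    if "i \<in> I" for i
    using pos[of "fst i"] that by (auto simp: I_def x_def)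
  note pb = pulled_back_ball[OF x(1) h(1) x(2), folded r'_def]
  have ImG: "2 * pi * real (snd i) \<le> Im (shift (k i) (G (of_real (x i))))"
    "Im (shift (k i) (G (of_real (x i)))) \<le> 2 * pi * real (snd i) + 2 * pi" for i
  proof -
    define y where "y = Im (G (of_real (x i)))"
    define c where "c = \<lceil>- y / (2 * pi)\<rceil>"
    have "- y / (2 * pi) \<le> of_int c" "of_int c \<le> - y / (2 * pi) + 1"
      unfolding c_def by linarith+
    then have "0 \<le> y + 2 * pi * of_int c" "y + 2 * pi * of_int c \<le> 2 * pi"
      by (simp_all add: field_simps)
    moreover have "Im (shift (k i) (G (of_real (x i)))) = y + 2 * pi * of_int c + 2 * pi * real (snd i)"
      by (simp add: Im_shift k_def x_def y_def c_def algebra_simps)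
    ultimately show "2 * pi * real (snd i) \<le> Im (shift (k i) (G (of_real (x i))))"
      "Im (shift (k i) (G (of_real (x i)))) \<le> 2 * pi * real (snd i) + 2 * pi" by linarith+
  qed
  have near: "\<bar>Re (shift (k i) (G z)) - Re (G (of_real (x i)))\<bar> \<le> h / 8"
    "\<bar>Im (shift (k i) (G z)) - Im (shift (k i) (G (of_real (x i))))\<bar> \<le> h / 8"
    if i: "i \<in> I" and z: "z \<in> cball (of_real (x i)) (\<Lambda> * r' i)" for i z
    using pb(4)[OF i i z] abs_Re_le_cmod[of "G z - G (of_real (x i))"]
      abs_Im_le_cmod[of "G z - G (of_real (x i))"] by (auto simp: Im_shift)
  have cells: "t + 2 * h * real (fst i) - h / 8 \<le> Re (shift (k i) (G z))"
      "Re (shift (k i) (G z)) \<le> t + 2 * h * real (fst i) + 9 * h / 8"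
      "2 * pi * real (snd i) - 1/8 \<le> Im (shift (k i) (G z))"
      "Im (shift (k i) (G z)) \<le> 2 * pi * real (snd i) + 2 * pi + 1/8"
    if i: "i \<in> I" and z: "z \<in> cball (of_real (x i)) (\<Lambda> * r' i)" for i z
    using near[OF i z] x(3,4)[OF i] ImG[of i] h(2) by linarith+
  have inside: "shift (k i) (G z) \<in> cball (of_real t) r"
    if i: "i \<in> I" and z: "z \<in> cball (of_real (x i)) (\<Lambda> * r' i)" for i z
  proof -
    have "fst i < M" "snd i < J" using i S by (auto simp: I_def)
    then have "h * (real (fst i) + 1) \<le> h * real M" "pi * (real (snd i) + 1) \<le> pi * real J"
      using h pi_gt_zero by (intro mult_left_mono; simp)+
    define p p' where "p = 2 * h * real (fst i)" and "p' = 2 * pi * real (snd i)"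
    have "p + 2 * h \<le> r / 4" "p' + 2 * pi \<le> r / 4"
      using hM hJ \<open>h * (real (fst i) + 1) \<le> h * real M\<close> \<open>pi * (real (snd i) + 1) \<le> pi * real J\<close>
      by (simp_all add: p_def p'_def algebra_simps)
    moreover have "0 \<le> p" "0 \<le> p'" using h by (simp_all add: p_def p'_def)
    moreover note cells[OF i z, folded p_def p'_def]
    ultimately have "\<bar>Re (shift (k i) (G z)) - t\<bar> \<le> r / 4 + 1/8" "\<bar>Im (shift (k i) (G z))\<bar> \<le> r / 4 + 1/8"
      using h r100 pi_gt_zero unfolding abs_le_iff by linarith+
    then have "\<bar>Re (shift (k i) (G z) - of_real t)\<bar> \<le> r / 4 + 1/8"
      "\<bar>Im (shift (k i) (G z) - of_real t)\<bar> \<le> r / 4 + 1/8"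
      by simp_all
    then have "norm (shift (k i) (G z) - of_real t) \<le> r"
      using cmod_le[of "shift (k i) (G z) - of_real t"] r100 by linarith
    then show ?thesis by (simp add: dist_norm norm_minus_commute)
  qed
  have \<Lambda>r': "cball (of_real (x i)) (r' i) \<subseteq> cball (complex_of_real (x i)) (\<Lambda> * r' i)" "0 < r' i" "0 < \<Lambda> * r' i" if "i \<in> I" for i
  proof -
    show "0 < r' i" using pb(1)[OF that that] .
    then have "r' i * 1 \<le> r' i * \<Lambda>" using \<Lambda> by (intro mult_left_mono) auto
    then show "cball (of_real (x i)) (r' i) \<subseteq> cball (complex_of_real (x i)) (\<Lambda> * r' i)" by (auto simp: mult.commute)
    show "0 < \<Lambda> * r' i" using \<open>0 < r' i\<close> \<Lambda> by simp
  qed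
  have D: "D i \<subseteq> cball (of_real t) r" "D i \<noteq> {}" if "i \<in> I" for i
    using inside[OF that] \<Lambda>r'[OF that] by (auto simp: D_def)
  have pieceD: "piece (w i) = g ` D i" for i
    by (simp add: piece_def w_def D_def g'_def image_image)
  note subr = cball_subset_ball_\<Lambda>[OF r0, of "of_real t"]
  have into: "shift (k i) (G z) \<in> ball (of_real t) (\<Lambda> * r)"
    if "i \<in> I" "z \<in> ball (of_real (x i)) (\<Lambda> * r' i)" for i z
    using inside[OF that(1), of z] that(2) subr by auto
  have pm: "g' i holomorphic_on ball (of_real (x i)) (\<Lambda> * r' i)" "inj_on (g' i) (ball (of_real (x i)) (\<Lambda> * r' i))"
      "deriv (g' i) (of_real (x i)) = deriv g (shift (k i) (G (of_real (x i)))) * deriv G (of_real (x i))"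
    if i: "i \<in> I" for i
    unfolding g'_def
    by (rule pulled_back_map[OF holg injg pb(3)[OF i i] into[OF i] \<Lambda>r'(3)[OF i]]; assumption)+
  define c where "c i = shift (k i) (G (of_real (x i)))" for i
  have wtw: "wt (w i) = norm (deriv g (c i)) * (a * h)" if i: "i \<in> I" for i
    using pm(3)[OF i] pb(5)[OF i i] by (simp add: wt_def w_def c_def norm_mult)
  have dc: "d / 2 \<le> norm (deriv g (c i))" "norm (deriv g (c i)) \<le> 3/2 * d" if i: "i \<in> I" for i
  proof -
    have "c i \<in> cball (of_real t) r" unfolding c_def using inside[OF i] \<Lambda>r'[OF i] by simp
    from distortion[OF r0 holg injg this]
    have "norm (deriv g (c i) - deriv g (of_real t)) \<le> d / 2" by (simp add: d_def)
    then show "d / 2 \<le> norm (deriv g (c i))" "norm (deriv g (c i)) \<le> 3/2 * d"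
      using norm_triangle_ineq2[of "deriv g (c i)" "deriv g (of_real t)"]
        norm_triangle_ineq2[of "deriv g (of_real t)" "deriv g (c i)"] by (simp_all add: d_def norm_minus_commute)
  qed
  have wtv: "wt (g, t, r) = d * r" by (simp add: wt_def d_def)
  have ah: "0 < a * h" "a * h \<le> 1/12" using a_bounds h mult_mono[of a "1/12" h 1] by auto
  have valid: "node T (w i) \<and> child (g, t, r) (w i)" if i: "i \<in> I" for i
  proof -
    have "0 \<le> h * real (fst i)" using h by simp
    then have "t \<le> Re (G (of_real (x i)))" using x(3)[OF i] by linarith
    note far = far[OF x(1)[OF i] this]
    have x0: "0 < x i" using x(1)[OF i] T0 by linarith
    have "x i powr (1 - e) * norm (deriv G (of_real (x i))) * (x i powr e) \<le> a * h * x i powr e"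
    proof -
      have "x i powr (1 - e) * norm (deriv G (of_real (x i))) * (x i powr e) = x i * norm (deriv G (of_real (x i)))"
        using x0 by (simp add: powr_diff)
      also have "\<dots> \<le> a * h * x i powr e"
        using deriv_G_bound[OF x(1)[OF i]] far by (simp add: h_def)
      finally show ?thesis .
    qed
    then have "x i powr (1 - e) * norm (deriv G (of_real (x i))) \<le> a * h"
      using x0 by simp
    moreover have "0 < norm (deriv G (of_real (x i)))"
      using x(2)[OF i] h by (cases "deriv G (of_real (x i)) = 0") auto
    \<comment> \<open>The radius \<open>a h / \<bar>G'(x)\<bar>\<close> is at least of order \<open>h x\<close>, and \<open>x\<close> is exponentially large compared with
      \<open>1/h\<close>. So the radius of the child stays above \<open>x\<^bsup>1-e\<^esup>\<close>.\<close>
    ultimately have rr: "x i powr (1 - e) \<le> r' i"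
      by (simp add: r'_def pos_le_divide_eq)
    have "norm (deriv g (c i)) * (a * h) \<le> 3/2 * d * (1/12)"
      using dc[OF i] ah d0 by (intro mult_mono) auto
    also have "\<dots> \<le> d * r / 2" using mult_left_mono[of 1 r d] r100 d0 by simp
    finally have "2 * wt (w i) \<le> wt (g, t, r)" unfolding wtw[OF i] wtv by simp
    moreover have "node T (w i)"
      using far t1 tT rr pb(2)[OF i i] pm(1,2)[OF i] by (simp add: node_def w_def)
    moreover have "\<exists>k'. g' i = (\<lambda>z. g (shift k' (G z))) \<and>
        (\<forall>z\<in>cball (of_real (x i)) (r' i). shift k' (G z) \<in> cball (of_real t) r)"
      using inside[OF i] \<Lambda>r'(1)[OF i] by (intro exI[of _ "k i"]) (auto simp: g'_def)
    ultimately show ?thesis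
      using far by (simp add: child_def w_def)
  qed
  have sep: "h / 2 \<le> norm (y - y')" if i: "i \<in> I" "i' \<in> I" "i \<noteq> i'" and y: "y \<in> D i" "y' \<in> D i'" for i i' y y'
  proof -
    obtain z z' where z: "z \<in> cball (of_real (x i)) (\<Lambda> * r' i)" "y = shift (k i) (G z)"
      and z': "z' \<in> cball (of_real (x i')) (\<Lambda> * r' i')" "y' = shift (k i') (G z')"
      using y \<Lambda>r'(1) i unfolding D_def by blast
    show ?thesis
    proof (cases "fst i = fst i'")
      case False
      define m m' where "m = real (fst i)" and "m' = real (fst i')"
      have "m + 1 \<le> m' \<or> m' + 1 \<le> m" using False by (auto simp: m_def m'_def)
      then have "h * m + h \<le> h * m' \<or> h * m' + h \<le> h * m"
        using mult_left_mono[of "m + 1" m' h] mult_left_mono[of "m' + 1" m h] h by (auto simp: algebra_simps)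
      then have "h / 2 \<le> \<bar>Re y - Re y'\<bar>"
        using cells(1,2)[OF i(1) z(1), folded z(2) m_def] cells(1,2)[OF i(2) z'(1), folded z'(2) m'_def] by linarith
      then show ?thesis using abs_Re_le_cmod[of "y - y'"] by simp
    next
      case True
      define j j' where "j = real (snd i)" and "j' = real (snd i')"
      have "x i = x i'" using True by (simp add: x_def)
      then have "Im (c i) - Im (c i') = 2 * pi * (j - j')"
        using True by (simp add: c_def Im_shift k_def j_def j'_def algebra_simps)
      moreover have "snd i \<noteq> snd i'" using i(3) True by (simp add: prod_eq_iff)
      then have "1 \<le> \<bar>j - j'\<bar>" by (auto simp: j_def j'_def)
      then have "2 * pi * 1 \<le> 2 * pi * \<bar>j - j'\<bar>" by (intro mult_left_mono) auto
      then have "2 * pi \<le> \<bar>2 * pi * (j - j')\<bar>" by (simp add: abs_mult)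
      ultimately have "2 * pi \<le> \<bar>Im (c i) - Im (c i')\<bar>" by simp
      then have "h / 2 \<le> \<bar>Im y - Im y'\<bar>"
        using near(2)[OF i(1) z(1), folded z(2) c_def] near(2)[OF i(2) z'(1), folded z'(2) c_def] h pi_gt3 by linarith
      then show ?thesis using abs_Im_le_cmod[of "y - y'"] by simp
    qed
  qed
  have bil: "norm (y - y') \<le> 2 * norm (g y - g y') / d" if "y \<in> cball (of_real t) r" "y' \<in> cball (of_real t) r" for y y'
    using bilipschitz(2)[OF holg injg r0 that] d0 by (simp add: d_def field_simps)
  have "inj_on w I"
  proof (rule inj_onI, rule ccontr)
    fix i i' assume i: "i \<in> I" "i' \<in> I" "w i = w i'" "i \<noteq> i'"
    obtain y where y: "y \<in> D i" using D(2)[OF i(1)] by blast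
    then have "g y \<in> g ` D i'" using pieceD[of i] pieceD[of i'] i(3) by simp
    then obtain y' where y': "y' \<in> D i'" "g y = g y'" by blast
    have "y \<in> cball (of_real t) r" "y' \<in> cball (of_real t) r"
      using subsetD[OF D(1)[OF i(1)] y] subsetD[OF D(1)[OF i(2)] y'(1)] .
    then have "norm (y - y') \<le> 0" using bil[of y y'] y'(2) by simp
    then show False using sep[OF i(1,2,4) y y'(1)] h by simp
  qed
  then have cardC: "card (w ` I) = card I" by (rule card_image)
  define N where "N = real (card I)"
  have Nge: "r\<^sup>2 / (512 * pi * h) \<le> N"
  proof -
    have "r / (32 * h) \<le> real (card S)" using M(1) S(2) by simp
    then have "r / (32 * h) * (r / (16 * pi)) \<le> real (card S) * real J"
      using J(1) r0 h by (intro mult_mono) auto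
    then show ?thesis by (simp add: N_def I_def power2_eq_square card_cartesian_product field_simps)
  qed
  have "0 < r\<^sup>2 / (512 * pi * h)" using r0 h by simp
  then have N0: "0 < N" using Nge by linarith
  have heavy: "wt (g, t, r) powr s \<le> N * wt (w i) powr s" if i: "i \<in> I" for i
  proof -
    have "r powr 2 = r powr s * r powr (2 - s)" "h powr s = h * h powr (s - 1)"
      using r0 h by (simp_all add: powr_mult_base flip: powr_add)
    then have eq: "r\<^sup>2 / (512 * pi * h) * h powr s = r powr s * W / (512 * pi)"
      using h r0 by (simp add: W_def)
    have a4: "a\<^sup>2 / 4 \<le> (a / 2) powr s"
    proof -
      have "(a / 2) powr 2 \<le> (a / 2) powr s" using a_bounds s by (intro powr_mono') auto
      then show ?thesis using a_bounds by (simp add: power_divide)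
    qed
    have "r powr s * 1 \<le> r powr s * (W / (512 * pi) * (a\<^sup>2 / 4))"
      using order_trans[OF keya tW] a_bounds by (intro mult_left_mono) (auto simp: field_simps)
    also have "\<dots> = r\<^sup>2 / (512 * pi * h) * h powr s * (a\<^sup>2 / 4)" using eq by simp
    also have "\<dots> \<le> N * h powr s * (a / 2) powr s"
      using Nge a4 N0 by (intro mult_mono) auto
    finally have "d powr s * r powr s \<le> d powr s * (N * (h powr s * (a / 2) powr s))"
      by (simp add: mult_left_mono)
    also have "\<dots> = N * (d / 2 * (a * h)) powr s"
    proof -
      have "d / 2 * (a * h) = d * (h * (a / 2))" by simp
      moreover have "(d * (h * (a / 2))) powr s = d powr s * (h powr s * (a / 2) powr s)"
        by (simp only: powr_mult)
      ultimately show ?thesis by (simp only: mult_ac)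
    qed
    also have "\<dots> \<le> N * wt (w i) powr s"
      unfolding wtw[OF i] using dc[OF i] d0 ah s N0 by (intro mult_left_mono powr_mono2 mult_right_mono) auto
    finally show ?thesis unfolding wtv using d0 r0 by (simp add: powr_mult)
  qed
  have spread: "1 / (20480 * pi) * real (card {v \<in> w ` I. V \<inter> piece v \<noteq> {}}) * wt (g, t, r) powr s \<le> N * diameter V powr s"
    if V: "bounded V" and v1: "v1 \<in> w ` I" "V \<inter> piece v1 \<noteq> {}" and v2: "v2 \<in> w ` I" "V \<inter> piece v2 \<noteq> {}" and ne: "v1 \<noteq> v2"
    for V v1 v2
  proof -
    define A where "A = {i\<in>I. V \<inter> piece (w i) \<noteq> {}}"
    \<comment> \<open>The diameter of \<open>V\<close>, measured in the disc about \<open>t\<close> before \<open>g\<close> is applied; the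
      factor 2 accounts for the distortion of \<open>g\<close>.\<close>
    define \<delta> where "\<delta> = 2 * diameter V / d"
    have finA: "finite A" using finI by (simp add: A_def)
    have close: "\<exists>y\<in>D i. \<exists>y'\<in>D i'. norm (y - y') \<le> \<delta>" if i: "i \<in> A" "i' \<in> A" for i i'
    proof -
      obtain y y' where y: "y \<in> D i" "g y \<in> V" "y' \<in> D i'" "g y' \<in> V"
        using i unfolding A_def pieceD by blast
      have "norm (g y - g y') \<le> diameter V"
        using diameter_bounded_bound[OF V y(2,4)] by (simp add: dist_norm)
      then have "2 * norm (g y - g y') / d \<le> \<delta>" unfolding \<delta>_def using d0 by (intro divide_right_mono) auto
      moreover have "norm (y - y') \<le> 2 * norm (g y - g y') / d"
        using bil[of y y'] subsetD[OF D(1)[of i] y(1)] subsetD[OF D(1)[of i'] y(3)] i by (simp add: A_def)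
      ultimately show ?thesis using y by (intro bexI[of _ y] bexI[of _ y']) auto
    qed
    obtain i1 i2 where i12: "i1 \<in> A" "i2 \<in> A" "i1 \<noteq> i2"
      using v1 v2 ne unfolding A_def by blast
    have h\<delta>: "h \<le> 2 * \<delta>"
    proof -
      obtain y y' where y: "y \<in> D i1" "y' \<in> D i2" "norm (y - y') \<le> \<delta>" using close[OF i12(1,2)] by blast
      have "h / 2 \<le> norm (y - y')" using sep[OF _ _ i12(3) y(1,2)] i12 by (simp add: A_def)
      then show ?thesis using y(3) by simp
    qed
    have "real (card A) \<le> 5 * (\<delta> / h) * (\<delta> + 3)"
    proof (rule grid_cluster_card_le[OF finA h(1) h\<delta> _ close])
      fix m j y assume mj: "(m, j) \<in> A" and y: "y \<in> D (m, j)"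
      have iI: "(m, j) \<in> I" using mj by (simp add: A_def)
      obtain z where z: "z \<in> cball (of_real (x (m, j))) (\<Lambda> * r' (m, j))" "y = shift (k (m, j)) (G z)"
        using y \<Lambda>r'(1)[OF iI] unfolding D_def by blast
      show "t + 2 * h * real m - h / 8 \<le> Re y \<and> Re y \<le> t + 2 * h * real m + 9 * h / 8 \<and>
        2 * pi * real j - 1 / 8 \<le> Im y \<and> Im y \<le> 2 * pi * real j + 2 * pi + 1 / 8"
        using cells[OF iI z(1)] unfolding z(2) by simp
    qed
    moreover have "real (card A) \<le> N" unfolding N_def A_def using finI by (intro of_nat_mono card_mono) auto
    moreover have "6 \<le> r powr (2 - s) * h powr (s - 1)" using order_trans[OF key6 tW] by (simp add: W_def)
    moreover have "0 < \<delta>" using h\<delta> h by linarith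
    ultimately have "1 / (20480 * pi) * real (card A) * r powr s \<le> N * (\<delta> / 2) powr s"
      using r0 h h\<delta> s Nge by (intro spread_estimate) auto
    then have "d powr s * (1 / (20480 * pi) * real (card A) * r powr s) \<le> d powr s * (N * (\<delta> / 2) powr s)"
      by (intro mult_left_mono) auto
    moreover have "d powr s * (\<delta> / 2) powr s = diameter V powr s"
      using d0 \<open>0 < \<delta>\<close> diameter_ge_0[OF V] by (simp add: \<delta>_def flip: powr_mult)
    moreover have "wt (g, t, r) powr s = d powr s * r powr s" unfolding wtv using d0 r0 by (simp add: powr_mult)
    moreover have "{v \<in> w ` I. V \<inter> piece v \<noteq> {}} = w ` A" unfolding A_def by blast
    then have "real (card {v \<in> w ` I. V \<inter> piece v \<noteq> {}}) = real (card A)"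
      using card_image[OF inj_on_subset[OF \<open>inj_on w I\<close>, of A]] by (simp add: A_def)
    ultimately show ?thesis by (simp add: mult_ac)
  qed
  have "balanced_branching s (1 / (20480 * pi)) piece wt (g, t, r) (w ` I)"
    unfolding balanced_branching_def cardC N_def[symmetric]
  proof (intro conjI ballI allI impI)
    show "finite (w ` I)" using finI by simp
    show "w ` I \<noteq> {}" using N0 by (auto simp: N_def)
    show "piece v \<subseteq> piece (g, t, r)" if v: "v \<in> w ` I" for v
    proof -
      obtain i where i: "i \<in> I" "v = w i" using v by blast
      show ?thesis
        using image_mono[OF D(1)[OF i(1)], of g] unfolding i(2) pieceD by (simp add: piece_def)
    qed
    show "wt (g, t, r) powr s \<le> N * wt v powr s" if "v \<in> w ` I" for v
      using that heavy by auto
    show "1 / (20480 * pi) * real (card {v \<in> w ` I. V \<inter> piece v \<noteq> {}}) * wt (g, t, r) powr s \<le> N * diameter V powr s"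
      if "bounded V" "\<exists>v\<in>w ` I. \<exists>v'\<in>w ` I. v \<noteq> v' \<and> V \<inter> piece v \<noteq> {} \<and> V \<inter> piece v' \<noteq> {}" for V
      using that spread by blast
  qed
  moreover have "\<forall>v\<in>w ` I. node T v \<and> child (g, t, r) v" using valid by blast
  ultimately show ?thesis by blast
qed

section \<open>The dimension of the escaping set\<close>

text \<open>The tree starts with a disc about a large real number, carried into the tract by \<open>exp \<circ> G\<close>.\<close>

theorem hausdorff_measure_escaping_set_pos:
  assumes G: "\<And>z. Re z > \<rho> \<Longrightarrow> exp (G z) \<in> D" "\<And>z. Re z > \<rho> \<Longrightarrow> f (exp (G z)) = exp z"
  shows "hausdorff_measure s (escaping_set f D) \<noteq> 0"
proof -
  have "\<forall>\<^sub>F t in at_top. \<Lambda> * t powr (1 - e) + \<rho> \<le> t" "\<forall>\<^sub>F t in at_top. t powr (1 - e) \<le> t / 2"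
    using e \<Lambda> by real_asymp+
  with eventually_large eventually_gt_at_top[of "2 * \<rho>"]
  have "\<forall>\<^sub>F t in at_top. large t \<and> 2 * \<rho> < t \<and> \<Lambda> * t powr (1 - e) + \<rho> \<le> t \<and> t powr (1 - e) \<le> t / 2"
    by eventually_elim simp
  then obtain T where T: "\<And>t. T \<le> t \<Longrightarrow> large t \<and> 2 * \<rho> < t \<and> \<Lambda> * t powr (1 - e) + \<rho> \<le> t \<and> t powr (1 - e) \<le> t / 2"
    unfolding eventually_at_top_linorder by blast
  have T\<rho>: "2 * \<rho> < T" "0 < T" using T[of T] \<rho>_pos by auto
  define r0 where "r0 = T powr (1 - e)"
  define g0 where "g0 z = exp (G z)" for z
  have "0 < r0" using T\<rho> by (simp add: r0_def)
  have sub: "ball (complex_of_real T) (\<Lambda> * r0) \<subseteq> {z. Re z > \<rho>}"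
    by (rule ball_half_plane) (use T[of T] in \<open>simp add: r0_def\<close>)
  have hol: "g0 holomorphic_on ball (of_real T) (\<Lambda> * r0)"
    unfolding g0_def by (intro holomorphic_intros holomorphic_on_subset[OF holG sub])
  have inj: "inj_on g0 (ball (of_real T) (\<Lambda> * r0))"
    unfolding g0_def using inj_on_subset[OF inj_exp_G sub] .
  have node0: "node T (g0, T, r0)"
    using hol inj T[of T] by (simp add: node_def r0_def)
  have "0 < \<Lambda> * r0" using \<Lambda> \<open>0 < r0\<close> by simp
  then have wt0: "0 < wt (g0, T, r0)"
    using holomorphic_injective_imp_regular[OF hol open_ball inj, of "of_real T"] \<open>0 < r0\<close> by (simp add: wt_def)
  have pi1: "1 / (20480 * pi) \<le> 1" using pi_gt3 by (simp add: field_simps)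
  show ?thesis
  proof (rule hausdorff_measure_pos_of_tree[where valid = "node T" and wt = wt and P = piece and step = child
        and c = "1 / (20480 * pi)", OF node0 wt0])
    show "\<exists>C. balanced_branching s (1 / (20480 * pi)) piece wt v C \<and> (\<forall>w\<in>C. node T w \<and> child v w)"
      if "node T v" for v
    proof (cases v)
      case (fields g t r)
      then show ?thesis using branching[of T g t r] that T\<rho>(2) T by blast
    qed
    show "1 / (20480 * pi) * wt v powr s \<le> diameter U powr s" if v: "node T v" and U: "bounded U" "piece v \<subseteq> U" for v U
    proof (cases v)
      case (fields g t r)
      have "0 < r" using node_r_pos[of T g t r] v T\<rho>(2) fields by simp
      then have "0 \<le> wt v" by (simp add: fields wt_def)
      have "wt v \<le> diameter U" using wt_le_diameter[of T g t r U] v T\<rho>(2) U fields by simp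
      then have "wt v powr s \<le> diameter U powr s" using \<open>0 \<le> wt v\<close> s by (intro powr_mono2) auto
      moreover have "1 / (20480 * pi) * wt v powr s \<le> 1 * wt v powr s" using pi1 by (intro mult_right_mono) auto
      ultimately show ?thesis by simp
    qed
    show "piece v \<noteq> {}" if v: "node T v" for v
    proof (cases v)
      case (fields g t r)
      then show ?thesis using node_r_pos[of T g t r] v T\<rho>(2) by (simp add: piece_def)
    qed
    show "\<exists>x\<in>escaping_set f D. \<forall>V. open V \<and> x \<in> V \<longrightarrow> (\<exists>n. piece (\<sigma> n) \<subseteq> V)"
      if \<sigma>: "\<sigma> 0 = (g0, T, r0)" "\<And>n. node T (\<sigma> n)" "\<And>n. child (\<sigma> n) (\<sigma> (Suc n))" for \<sigma>
    proof -
      obtain \<zeta> where \<zeta>: "\<And>n. Re (\<zeta> n) > \<rho>" "\<And>n. exp (\<zeta> n) = exp (G (\<zeta> (Suc n)))"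
        "filterlim (\<lambda>n. Re (\<zeta> n)) at_top sequentially"
        "\<And>V. open V \<Longrightarrow> g0 (\<zeta> 0) \<in> V \<Longrightarrow> \<exists>n. piece (\<sigma> n) \<subseteq> V"
        using limit_point[OF T\<rho>(2,1) \<sigma>] by metis
      have "g0 (\<zeta> 0) \<in> escaping_set f D"
        unfolding g0_def by (rule escaping_if_backward_orbit_tends_to_infinity[OF G \<zeta>(1,2,3)])
      then show ?thesis using \<zeta>(4) by blast
    qed
  qed (use s in auto)
qed

end

text \<open>For \<open>s < 1 + 1 / q\<close> some room is left in \<open>q (s - 1) < 1\<close>, and the exponent \<open>e\<close> is
  chosen to fit into this room.\<close>

theorem theorem1p2:
  fixes f :: "complex \<Rightarrow> complex" and D :: "complex set" and q :: real
  assumes "q \<ge> 1"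
    and "logarithmic_tract f D"
    and "\<And>\<epsilon>::real. \<epsilon> > 0 \<Longrightarrow>
           \<exists>r>0. \<forall>z\<in>D. cmod z \<ge> r \<longrightarrow> cmod (f z) \<le> exp (exp ((ln (cmod z)) powr (q + \<epsilon>)))"
  shows "hausdorff_dim (escaping_set f D) \<ge> ennreal (1 + 1 / q)"
proof -
  have D: "open D" "f holomorphic_on D" "continuous_on (closure D) f"
    using assms(2) by (auto simp: logarithmic_tract_def)
  obtain R where R: "R > 0" "covering_space D f (Delta R)" "simply_connected D"
    using assms(2) by (auto simp: logarithmic_tract_def universal_covering_def)
  obtain \<rho> G where G: "\<rho> > 0" "G holomorphic_on {z. Re z > \<rho>}"
    "inj_on (\<lambda>z. exp (G z)) {z. Re z > \<rho>}"
    "\<And>z. Re z > \<rho> \<Longrightarrow> exp (G z) \<in> D" "\<And>z. Re z > \<rho> \<Longrightarrow> f (exp (G z)) = exp z"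
    using tract_log_coordinate[OF R(2,1,3) D(1,2)] by metis
  obtain \<Lambda> :: real where \<Lambda>: "\<Lambda> \<ge> 2"
    "\<And>g a r x. \<lbrakk>0 < r; g holomorphic_on ball a (\<Lambda> * r); inj_on g (ball a (\<Lambda> * r)); x \<in> cball a r\<rbrakk>
       \<Longrightarrow> norm (deriv g x - deriv g a) \<le> norm (deriv g a) / 2"
    using univalent_deriv_distortion by metis
  have below: "ennreal s \<le> hausdorff_dim (escaping_set f D)" if s: "1 < s" "s < 1 + 1 / q" for s
  proof -
    \<comment> \<open>The room left, of which \<open>e\<close> uses a quarter: the inequality \<open>key\<close> needs \<open>e (2 s - 1) < \<gamma>\<close>,
      and \<open>2 s - 1\<close> is below 4.\<close>
    define \<gamma> where "\<gamma> = 1 - q * (s - 1)"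
    define e where "e = \<gamma> / 4"
    have "\<gamma> > 0" using s \<open>q \<ge> 1\<close> by (simp add: \<gamma>_def field_simps)
    have "1 / q \<le> 1" using \<open>q \<ge> 1\<close> by simp
    then have "s < 2" using s by linarith
    have "\<gamma> \<le> 1" using s \<open>q \<ge> 1\<close> by (simp add: \<gamma>_def)
    have e: "0 < e" "e < 1" using \<open>\<gamma> > 0\<close> \<open>\<gamma> \<le> 1\<close> by (auto simp: e_def)
    have "\<gamma> * (2 * s - 1) < \<gamma> * 4" using \<open>\<gamma> > 0\<close> \<open>s < 2\<close> by (intro mult_strict_left_mono) auto
    then have "0 < \<gamma> - e * (2 * s - 1)" by (simp add: e_def)
    also have "\<dots> = (1 - e) * (2 - s) - (q - 1 + 3 * e) * (s - 1)"
      by (simp add: \<gamma>_def algebra_simps)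
    finally have "(q - 1 + 3 * e) * (s - 1) < (1 - e) * (2 - s)" by simp
    obtain T where T: "T > \<rho>" "T \<ge> 1"
      "\<And>x::real. x \<ge> T \<Longrightarrow> Re (G x) \<ge> 1 \<and> ln x \<le> Re (G x) powr (q + e)"
      using tract_growth_in_log_coordinate[OF D(3) G(4,5) assms(3)[OF e(1)]] by metis
    interpret log_tract G \<rho> "max T (2 * \<rho> + 1)" \<Lambda> q e s
    proof
      show "(q - 1 + 3 * e) * (s - 1) < (1 - e) * (2 - s)" by fact
    qed (use G(1-3) \<Lambda> T \<open>q \<ge> 1\<close> e s \<open>s < 2\<close> in auto)
    show ?thesis
      using hausdorff_dim_geI[OF hausdorff_measure_escaping_set_pos[OF G(4,5)]] s by simp
  qed
  show ?thesis
  proof (rule ccontr)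
    assume not: "\<not> ?thesis"
    then obtain x where x: "x \<ge> 0" "hausdorff_dim (escaping_set f D) = ennreal x"
      by (cases "hausdorff_dim (escaping_set f D)") auto
    have "1 / q > 0" using \<open>q \<ge> 1\<close> by simp
    have "x < 1 + 1 / q" 
    proof (rule ccontr)
      assume "\<not> x < 1 + 1 / q"
      then have "ennreal (1 + 1 / q) \<le> ennreal x" by (intro ennreal_leI) simp
      then show False using not x(2) by simp
    qed
    then obtain s where "max 1 x < s" "s < 1 + 1 / q" using dense[of "max 1 x" "1 + 1 / q"] \<open>1 / q > 0\<close> by auto
    then show False using below[of s] x by (simp add: ennreal_le_iff)
  qed
qed

end
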